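(* The class of circulant coset S-rings is closed under restriction to a section and under tensor and generalized wreath products, and consists of quasidense S-rings. That is: (a) if $\mathcal{A}$ is a coset S-ring over a finite cyclic group $G$ and $S$ is an $\mathcal{A}$-section, then $\mathcal{A}_S$ is a coset S-ring; (b) if $\mathcal{A}_1$ and $\mathcal{A}_2$ are coset S-rings over finite cyclic groups $G_1$ and $G_2$ such that $G_1\times G_2$ is cyclic, then $\mathcal{A}_1\otimes\mathcal{A}_2$ is a coset S-ring; (c) if an S-ring $\mathcal{A}$ over a finite cyclic group $G$ is a $U/L$-wreath product for some $\mathcal{A}$-section $U/L$, and $\mathcal{A}_U$ and $\mathcal{A}_{G/L}$ are coset S-rings, then $\mathcal{A}$ is a coset S-ring; (d) every coset S-ring over a finite cyclic group is quasidense.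
   Context: An S-ring over a finite group $G$ is a subring $\mathcal{A}$ of the group ring $\mathbb{Z}G$ for which there is a partition $\mathcal{S}(\mathcal{A})$ of $G$ (its classes are called basic sets) such that $\{1_G\}\in\mathcal{S}(\mathcal{A})$; $X\in\mathcal{S}(\mathcal{A})$ implies $X^{-1}\in\mathcal{S}(\mathcal{A})$; and $\mathcal{A}$ is the $\mathbb{Z}$-span of the elements $\sum_{x\in X}x$, $X\in\mathcal{S}(\mathcal{A})$. It is circulant if $G$ is cyclic. An $\mathcal{A}$-group is a subgroup of $G$ that is a union of basic sets. A section $S=U/L$ of $G$ ($L$ normal in $U\le G$) is an $\mathcal{A}$-section if $U$ and $L$ are $\mathcal{A}$-groups; then $\mathcal{A}_S$ denotes the S-ring over $S$ whose basic sets are $\pi_S(X)$, $X\in\mathcal{S}(\mathcal{A})$, $X\subseteq U$, where $\pi_S:U\to S$ is the quotient epimorphism; a subgroup $U$ is identified with $U/1$. An S-ring over a nontrivial group is primitive if its only $\mathcal{A}$-groups are the trivial one and the whole group; an $\mathcal{A}$-section $S$ is primitive if $\mathcal{A}_S$ is. A circulant S-ring is quasidense if every primitive section of it has prime order. The tensor product $\mathcal{A}_1\otimes\mathcal{A}_2$ is the S-ring over $G_1\times G_2$ with basic sets $X_1\times X_2$, $X_i\in\mathcal{S}(\mathcal{A}_i)$. For $X\subseteq G$, $\mathrm{rad}(X)=\{g\in G: gX=Xg=X\}$. $\mathcal{A}$ is a $U/L$-wreath product (generalized wreath product), where $U/L$ is an $\mathcal{A}$-section, if $L$ is normal in $G$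 and $L\le\mathrm{rad}(X)$ for all basic sets $X$ of $\mathcal{A}$ outside $U$. A coset S-ring over an abelian group $G$ is an S-ring each basic set of which is a coset of a subgroup of $G$. *)

theory Defs
  imports "HOL-Algebra.Elementary_Groups" "HOL-Algebra.Subrings" "HOL-Computational_Algebra.Primes" "HOL-Library.Disjoint_Sets" "HOL-Library.Indicator_Function"
begin

section \<open>The integral group ring\<close>

text \<open>
  The group ring \<open>\<int>G\<close> of a finite group \<open>G\<close>: an element \<open>\<Sum>\<^sub>x f x \<cdot> x\<close> is represented by its
  coefficient function \<open>f\<close>, which vanishes off the carrier. For infinite \<open>G\<close> this is not the
  group ring (no finiteness of support is required); it is only used for finite \<open>G\<close>.
\<close>

definition group_ring :: "('a, 'm) monoid_scheme \<Rightarrow> ('a \<Rightarrow> int) ring" where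
  "group_ring G =
     \<lparr>carrier = {f. \<forall>x. x \<notin> carrier G \<longrightarrow> f x = 0},
      monoid.mult = (\<lambda>f g z. \<Sum>(x, y)\<in>{(x, y). x \<in> carrier G \<and> y \<in> carrier G \<and> x \<otimes>\<^bsub>G\<^esub> y = z}. f x * g y),
      one = indicator {\<one>\<^bsub>G\<^esub>},
      ring.zero = (\<lambda>x. 0),
      ring.add = (\<lambda>f g x. f x + g x)\<rparr>"

lemma (in group) group_ring_mult:
  assumes "z \<in> carrier G"
  shows "(f \<otimes>\<^bsub>group_ring G\<^esub> g) z = (\<Sum>x\<in>carrier G. f x * g (inv x \<otimes> z))"
proof -
  have "{(x, y). x \<in> carrier G \<and> y \<in> carrier G \<and> x \<otimes> y = z} = (\<lambda>x. (x, inv x \<otimes> z)) ` carrier G"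
    using assms by (auto simp: image_iff simp flip: m_assoc)
  then show ?thesis
    by (simp add: group_ring_def sum.reindex inj_on_def)
qed

lemma (in group) ring_group_ring:
  assumes fin: "finite (carrier G)"
  shows "ring (group_ring G)"
proof (rule ringI)
  let ?R = "group_ring G"
  have off: "(f \<otimes>\<^bsub>?R\<^esub> g) z = 0" if "z \<notin> carrier G" for f g z
  proof -
    have "{(x, y). x \<in> carrier G \<and> y \<in> carrier G \<and> x \<otimes> y = z} = {}" using that by auto
    then have "(\<Sum>(x, y)\<in>{(x, y). x \<in> carrier G \<and> y \<in> carrier G \<and> x \<otimes> y = z}. f x * g y) = 0"
      by (simp only: sum.empty)
    then show ?thesis by (simp add: group_ring_def)
  qed
  show "abelian_group ?R"
  proof (rule abelian_groupI)
    fix f assume "f \<in> carrier ?R"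
    then have "(\<lambda>x. - f x) \<in> carrier ?R \<and> (\<lambda>x. - f x) \<oplus>\<^bsub>?R\<^esub> f = \<zero>\<^bsub>?R\<^esub>"
      by (simp add: group_ring_def)
    then show "\<exists>g\<in>carrier ?R. g \<oplus>\<^bsub>?R\<^esub> f = \<zero>\<^bsub>?R\<^esub>" by blast
  qed (auto simp: group_ring_def)
  show "monoid ?R"
  proof (rule monoidI)
    show "\<one>\<^bsub>?R\<^esub> \<in> carrier ?R" by (auto simp: group_ring_def indicator_def)
    show "f \<otimes>\<^bsub>?R\<^esub> g \<in> carrier ?R" for f g
      using off[of _ f g] by (simp add: group_ring_def)
    have ind: "indicator {\<one>} x = (if x = \<one> then 1 else (0::int))" for x :: 'a
      by (simp add: indicator_def)
    have one: "\<one>\<^bsub>?R\<^esub> = indicator {\<one>}" by (simp add: group_ring_def)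
    fix f g h assume f: "f \<in> carrier ?R" 
    have f0: "x \<notin> carrier G \<Longrightarrow> f x = 0" for x using f by (simp add: group_ring_def)
    show "\<one>\<^bsub>?R\<^esub> \<otimes>\<^bsub>?R\<^esub> f = f"
    proof
      fix z show "(\<one>\<^bsub>?R\<^esub> \<otimes>\<^bsub>?R\<^esub> f) z = f z"
      proof (cases "z \<in> carrier G")
        case True
        then have "(\<one>\<^bsub>?R\<^esub> \<otimes>\<^bsub>?R\<^esub> f) z = (\<Sum>x\<in>carrier G. if x = \<one> then f z else 0)"
          unfolding group_ring_mult[OF True] one ind by (intro sum.cong) auto
        then show ?thesis using fin by (simp add: sum.delta)
      qed (simp add: off f0)
    qed
    show "f \<otimes>\<^bsub>?R\<^esub> \<one>\<^bsub>?R\<^esub> = f"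
    proof
      fix z show "(f \<otimes>\<^bsub>?R\<^esub> \<one>\<^bsub>?R\<^esub>) z = f z"
      proof (cases "z \<in> carrier G")
        case True
        have "inv x \<otimes> z = \<one> \<longleftrightarrow> x = z" if "x \<in> carrier G" for x
          using that True by (metis inv_solve_left' one_closed r_one)
        then have "(f \<otimes>\<^bsub>?R\<^esub> \<one>\<^bsub>?R\<^esub>) z = (\<Sum>x\<in>carrier G. if x = z then f z else 0)"
          unfolding group_ring_mult[OF True] one ind by (intro sum.cong) auto
        then show ?thesis using fin True by (simp add: sum.delta)
      qed (simp add: off f0)
    qed
    show "(f \<otimes>\<^bsub>?R\<^esub> g) \<otimes>\<^bsub>?R\<^esub> h = f \<otimes>\<^bsub>?R\<^esub> (g \<otimes>\<^bsub>?R\<^esub> h)"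
    proof
      fix z show "((f \<otimes>\<^bsub>?R\<^esub> g) \<otimes>\<^bsub>?R\<^esub> h) z = (f \<otimes>\<^bsub>?R\<^esub> (g \<otimes>\<^bsub>?R\<^esub> h)) z"
      proof (cases "z \<in> carrier G")
        case True
        have "((f \<otimes>\<^bsub>?R\<^esub> g) \<otimes>\<^bsub>?R\<^esub> h) z =
            (\<Sum>x\<in>carrier G. \<Sum>u\<in>carrier G. f u * g (inv u \<otimes> x) * h (inv x \<otimes> z))"
          by (simp add: group_ring_mult True sum_distrib_right)
        also have "\<dots> = (\<Sum>u\<in>carrier G. \<Sum>x\<in>carrier G. f u * g (inv u \<otimes> x) * h (inv x \<otimes> z))"
          by (rule sum.swap)
        also have "\<dots> = (\<Sum>u\<in>carrier G. \<Sum>v\<in>carrier G. f u * g v * h (inv v \<otimes> (inv u \<otimes> z)))"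
        proof (rule sum.cong[OF refl])
          fix u assume u: "u \<in> carrier G"
          have cancel: "u \<otimes> (inv u \<otimes> x) = x" "inv u \<otimes> (u \<otimes> x) = x" if "x \<in> carrier G" for x
            using u that by (simp_all flip: m_assoc)
          show "(\<Sum>x\<in>carrier G. f u * g (inv u \<otimes> x) * h (inv x \<otimes> z)) =
                (\<Sum>v\<in>carrier G. f u * g v * h (inv v \<otimes> (inv u \<otimes> z)))"
            by (rule sum.reindex_bij_witness[of _ "\<lambda>v. u \<otimes> v" "\<lambda>x. inv u \<otimes> x"])
               (use u True in \<open>simp_all add: cancel m_assoc inv_mult_group\<close>)
        qed
        also have "\<dots> = (f \<otimes>\<^bsub>?R\<^esub> (g \<otimes>\<^bsub>?R\<^esub> h)) z"
          by (simp add: group_ring_mult True sum_distrib_left mult.assoc)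
        finally show ?thesis .
      qed (simp add: off)
    qed
  qed
  fix f g h
  show "(f \<oplus>\<^bsub>?R\<^esub> g) \<otimes>\<^bsub>?R\<^esub> h = f \<otimes>\<^bsub>?R\<^esub> h \<oplus>\<^bsub>?R\<^esub> g \<otimes>\<^bsub>?R\<^esub> h"
    by (simp add: group_ring_def fun_eq_iff case_prod_unfold sum.distrib distrib_right)
  show "h \<otimes>\<^bsub>?R\<^esub> (f \<oplus>\<^bsub>?R\<^esub> g) = h \<otimes>\<^bsub>?R\<^esub> f \<oplus>\<^bsub>?R\<^esub> h \<otimes>\<^bsub>?R\<^esub> g"
    by (simp add: group_ring_def fun_eq_iff case_prod_unfold sum.distrib distrib_left)
qed


section \<open>S-rings\<close>

text \<open>
  The \<open>\<int>\<close>-span of the elements \<open>\<Sum>\<^bsub>x\<in>X\<^esub> x\<close> for \<open>X \<in> \<S>\<close>; the coefficient function of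
  \<open>\<Sum>\<^bsub>x\<in>X\<^esub> x\<close> is the indicator function of \<open>X\<close>.
\<close>

definition int_span :: "'a set set \<Rightarrow> ('a \<Rightarrow> int) set" where
  "int_span \<S> = {(\<lambda>x. \<Sum>X\<in>\<S>. c X * indicator X x) | c. True}"

definition basic_partition ::
    "('a, 'm) monoid_scheme \<Rightarrow> ('a \<Rightarrow> int) set \<Rightarrow> 'a set set \<Rightarrow> bool" where
  "basic_partition G \<A> \<S> \<longleftrightarrow>
     partition_on (carrier G) \<S> \<and>
     {\<one>\<^bsub>G\<^esub>} \<in> \<S> \<and>
     (\<forall>X\<in>\<S>. (\<lambda>x. inv\<^bsub>G\<^esub> x) ` X \<in> \<S>) \<and>
     \<A> = int_span \<S>"

definition S_ring :: "('a, 'm) monoid_scheme \<Rightarrow> ('a \<Rightarrow> int) set \<Rightarrow> bool" where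
  "S_ring G \<A> \<longleftrightarrow>
     group G \<and> finite (carrier G) \<and> subring \<A> (group_ring G) \<and> (\<exists>\<S>. basic_partition G \<A> \<S>)"

text \<open>Well-defined for S-rings by \<open>basic_partition_unique\<close> below.\<close>

definition basic_sets :: "('a, 'm) monoid_scheme \<Rightarrow> ('a \<Rightarrow> int) set \<Rightarrow> 'a set set" where
  "basic_sets G \<A> = (THE \<S>. basic_partition G \<A> \<S>)"

lemma int_span_const:
  assumes "finite (carrier G)" "partition_on (carrier G) \<S>" "f \<in> int_span \<S>"
    and "X \<in> \<S>" "x \<in> X" "y \<in> X"
  shows "f x = f y"
proof -
  obtain c where f: "f = (\<lambda>x. \<Sum>X\<in>\<S>. c X * indicator X x)"
    using assms(3) by (auto simp: int_span_def)
  have "indicator Y x = (indicator Y y :: int)" if "Y \<in> \<S>" for Y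
    using assms that by (auto simp: partition_on_def disjoint_def indicator_def)
  then show ?thesis by (simp add: f)
qed

lemma indicator_in_int_span:
  assumes "finite \<S>" "X \<in> \<S>"
  shows "indicator X \<in> int_span \<S>"
proof -
  have "(\<Sum>Y\<in>\<S>. (if Y = X then 1 else 0) * indicator Y x) = (indicator X x :: int)" for x
    using assms by (simp add: if_distrib[of "\<lambda>c. c * _"] cong: if_cong)
  then have "indicator X = (\<lambda>x. \<Sum>Y\<in>\<S>. (if Y = X then 1 else 0) * (indicator Y x :: int))"
    by (intro ext) (rule sym)
  then show ?thesis unfolding int_span_def
    by (intro CollectI exI[of _ "\<lambda>Y. if Y = X then 1 else 0"] conjI TrueI)
qed

lemma basic_partition_subset:
  assumes fin: "finite (carrier G)" and S: "basic_partition G \<A> \<S>" and T: "basic_partition G \<A> \<T>"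
  shows "\<S> \<subseteq> \<T>"
proof
  have pS: "partition_on (carrier G) \<S>" and pT: "partition_on (carrier G) \<T>"
    and eq: "int_span \<S> = int_span \<T>"
    using S T by (auto simp: basic_partition_def)
  have finS: "finite \<S>" and finT: "finite \<T>"
    using fin pS pT finite_elements by blast+
  fix X assume X: "X \<in> \<S>"
  then obtain x where x: "x \<in> X" using pS by (metis ex_in_conv partition_on_def)
  then obtain Y where Y: "Y \<in> \<T>" "x \<in> Y" using X pS pT by (auto simp: partition_on_def)
  have "Y \<subseteq> X"
  proof
    fix y assume "y \<in> Y"
    then have "indicator X x = (indicator X y :: int)"
      using int_span_const[OF fin pT _ Y(1) Y(2), of "indicator X" y]
        indicator_in_int_span[OF finS X] eq by auto
    then show "y \<in> X" using x by (auto simp: indicator_def split: if_splits)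
  qed
  moreover have "X \<subseteq> Y"
  proof
    fix y assume "y \<in> X"
    then have "indicator Y x = (indicator Y y :: int)"
      using int_span_const[OF fin pS _ X x, of "indicator Y" y]
        indicator_in_int_span[OF finT Y(1)] eq by auto
    then show "y \<in> Y" using Y by (auto simp: indicator_def split: if_splits)
  qed
  ultimately show "X \<in> \<T>" using Y by auto
qed

lemma basic_partition_unique:
  assumes "finite (carrier G)" "basic_partition G \<A> \<S>" "basic_partition G \<A> \<T>"
  shows "\<S> = \<T>"
  using assms by (intro subset_antisym basic_partition_subset[of G \<A>])

lemma basic_sets_eq:
  assumes "finite (carrier G)" "basic_partition G \<A> \<S>"
  shows "basic_sets G \<A> = \<S>"
  unfolding basic_sets_def
  by (rule the_equality) (fact assms(2), rule basic_partition_unique[OF assms(1) _ assms(2)])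

definition circulant_S_ring :: "('a, 'm) monoid_scheme \<Rightarrow> ('a \<Rightarrow> int) set \<Rightarrow> bool" where
  "circulant_S_ring G \<A> \<longleftrightarrow> S_ring G \<A> \<and> cyclic_group G"


section \<open>Sections\<close>

definition A_group :: "('a, 'm) monoid_scheme \<Rightarrow> ('a \<Rightarrow> int) set \<Rightarrow> 'a set \<Rightarrow> bool" where
  "A_group G \<A> H \<longleftrightarrow> subgroup H G \<and> (\<exists>\<X>. \<X> \<subseteq> basic_sets G \<A> \<and> H = \<Union>\<X>)"

definition A_section :: "('a, 'm) monoid_scheme \<Rightarrow> ('a \<Rightarrow> int) set \<Rightarrow> 'a set \<Rightarrow> 'a set \<Rightarrow> bool" where
  "A_section G \<A> U L \<longleftrightarrow> A_group G \<A> U \<and> A_group G \<A> L \<and> L \<lhd> (G\<lparr>carrier := U\<rparr>)"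

text \<open>
  The quotient group \<open>U/L\<close> and the S-ring over it induced by \<open>\<A>\<close>; the quotient map sends \<open>x\<close> to
  the coset \<open>Lx\<close>. A subgroup \<open>U\<close> is treated as the section \<open>U/1\<close>, so its elements are singletons.
\<close>

definition section_group :: "('a, 'm) monoid_scheme \<Rightarrow> 'a set \<Rightarrow> 'a set \<Rightarrow> 'a set monoid" where
  "section_group G U L = (G\<lparr>carrier := U\<rparr>) Mod L"

definition section_S_ring ::
    "('a, 'm) monoid_scheme \<Rightarrow> ('a \<Rightarrow> int) set \<Rightarrow> 'a set \<Rightarrow> 'a set \<Rightarrow> ('a set \<Rightarrow> int) set" where
  "section_S_ring G \<A> U L =
     int_span {(\<lambda>x. L #>\<^bsub>G\<^esub> x) ` X | X. X \<in> basic_sets G \<A> \<and> X \<subseteq> U}"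

definition primitive_S_ring :: "('a, 'm) monoid_scheme \<Rightarrow> ('a \<Rightarrow> int) set \<Rightarrow> bool" where
  "primitive_S_ring G \<A> \<longleftrightarrow>
     S_ring G \<A> \<and> carrier G \<noteq> {\<one>\<^bsub>G\<^esub>} \<and>
     (\<forall>H. A_group G \<A> H \<longrightarrow> H = {\<one>\<^bsub>G\<^esub>} \<or> H = carrier G)"

definition quasidense :: "('a, 'm) monoid_scheme \<Rightarrow> ('a \<Rightarrow> int) set \<Rightarrow> bool" where
  "quasidense G \<A> \<longleftrightarrow>
     circulant_S_ring G \<A> \<and>
     (\<forall>U L. A_section G \<A> U L \<and> primitive_S_ring (section_group G U L) (section_S_ring G \<A> U L)
        \<longrightarrow> prime (order (section_group G U L)))"


section \<open>Products and coset S-rings\<close>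

definition tensor_S_ring ::
    "('a, 'm) monoid_scheme \<Rightarrow> ('a \<Rightarrow> int) set \<Rightarrow> ('b, 'n) monoid_scheme \<Rightarrow> ('b \<Rightarrow> int) set
      \<Rightarrow> ('a \<times> 'b \<Rightarrow> int) set" where
  "tensor_S_ring G\<^sub>1 \<A>\<^sub>1 G\<^sub>2 \<A>\<^sub>2 =
     int_span {X\<^sub>1 \<times> X\<^sub>2 | X\<^sub>1 X\<^sub>2. X\<^sub>1 \<in> basic_sets G\<^sub>1 \<A>\<^sub>1 \<and> X\<^sub>2 \<in> basic_sets G\<^sub>2 \<A>\<^sub>2}"

definition rad :: "('a, 'm) monoid_scheme \<Rightarrow> 'a set \<Rightarrow> 'a set" where
  "rad G X = {g \<in> carrier G. g <#\<^bsub>G\<^esub> X = X \<and> X #>\<^bsub>G\<^esub> g = X}"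

definition gen_wreath :: "('a, 'm) monoid_scheme \<Rightarrow> ('a \<Rightarrow> int) set \<Rightarrow> 'a set \<Rightarrow> 'a set \<Rightarrow> bool" where
  "gen_wreath G \<A> U L \<longleftrightarrow>
     A_section G \<A> U L \<and> L \<lhd> G \<and>
     (\<forall>X\<in>basic_sets G \<A>. X \<subseteq> carrier G - U \<longrightarrow> L \<subseteq> rad G X)"

text \<open>The subgroup may depend on the basic set.\<close>

definition coset_S_ring :: "('a, 'm) monoid_scheme \<Rightarrow> ('a \<Rightarrow> int) set \<Rightarrow> bool" where
  "coset_S_ring G \<A> \<longleftrightarrow>
     S_ring G \<A> \<and> comm_group G \<and>
     (\<forall>X\<in>basic_sets G \<A>. \<exists>H. subgroup H G \<and> X \<in> rcosets\<^bsub>G\<^esub> H)"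

end

theory Submission
  imports Defs "HOL-Algebra.Sylow"
begin

text \<open>
  An S-ring is the ring of all functions on the group that are constant on its basic sets, the
  multiplication being convolution. Two consequences drive everything. First, a statement that
  some functions form an S-ring reduces to the statement that a convolution is constant on
  classes (\<open>S_ring_int_span\<close>). Second, the product of two unions of basic sets is a union of
  basic sets (\<open>indicator_set_mult\<close>).

  For a section \<open>U/L\<close>, functions on the section are identified with functions on \<open>U\<close> that are
  constant on cosets of \<open>L\<close>; this identification respects convolution up to the factor \<open>card L\<close>
  (\<open>group_ring_mult_section\<close>), so the S-ring on the section is inherited from \<open>\<A>\<close>. Its basic
  sets are images of basic sets under a homomorphism, and a homomorphism maps cosets to cosets.
  For the tensor product, convolution is analysed one coordinate at a time
  (\<open>group_ring_mult_DirProd\<close>), and a product of cosets is a coset of the product subgroup.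

  In a generalized wreath product every basic set is the full preimage of its image in \<open>U/1\<close> or
  in \<open>G/L\<close>, and a full preimage of a coset is a coset (\<open>hom_preimage_coset\<close>).

  For quasidensity, restriction to a section reduces the claim to a primitive coset S-ring over
  an abelian group. The subgroup \<open>H\<close> of which a basic set \<open>X\<close> is a coset equals
  \<open>X \<cdot> X\<^sup>-\<^sup>1\<close> and so is an \<open>\<A>\<close>-group (\<open>coset_stabilizer_A_group\<close>). Primitivity leaves only
  singletons as basic sets, whence every subgroup is an \<open>\<A>\<close>-group, and a group whose only
  subgroups are the two trivial ones has prime order.
\<close>

section \<open>S-rings as rings of functions constant on classes\<close>

lemma int_span_zero:
  assumes "partition_on (carrier G) \<S>" "f \<in> int_span \<S>" "x \<notin> carrier G"
  shows "f x = 0"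
  using assms(2,3) partition_onD1[OF assms(1)]
  by (auto simp: int_span_def indicator_def intro!: sum.neutral)

text \<open>
  Together with \<open>int_span_zero\<close> and \<open>int_span_const\<close>, this describes the span of the class
  indicators as the functions that vanish off the carrier and are constant on every class. The
  coefficient of such a function at a class is its value at any point of the class.
\<close>

lemma int_spanI:
  assumes fin: "finite (carrier G)" and part: "partition_on (carrier G) \<S>"
    and zero: "\<And>x. x \<notin> carrier G \<Longrightarrow> f x = 0"
    and const: "\<And>X x y. \<lbrakk>X \<in> \<S>; x \<in> X; y \<in> X\<rbrakk> \<Longrightarrow> f x = f y"
  shows "f \<in> int_span \<S>"
proof -
  have finS: "finite \<S>" using finite_elements[OF fin part] .
  define c where "c X = f (SOME x. x \<in> X)" for X
  have "f x = (\<Sum>X\<in>\<S>. c X * indicator X x)" for x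
  proof (cases "x \<in> carrier G")
    case True
    then obtain Y where Y: "Y \<in> \<S>" "x \<in> Y" using partition_onD1[OF part] by auto
    have "(SOME x. x \<in> Y) \<in> Y" using Y(2) by (rule someI)
    then have cY: "c Y = f x" unfolding c_def using const Y by blast
    have "x \<in> X \<longleftrightarrow> X = Y" if "X \<in> \<S>" for X
      using partition_onD2[OF part] Y that unfolding disjoint_def by blast
    then have "(\<Sum>X\<in>\<S>. c X * indicator X x) = (\<Sum>X\<in>\<S>. if X = Y then c Y else 0)"
      by (intro sum.cong) (simp_all add: indicator_def)
    then show ?thesis using finS Y cY by simp
  next
    case False
    then have "(\<Sum>X\<in>\<S>. c X * indicator X x) = 0"
      using partition_onD1[OF part] by (intro sum.neutral) (auto simp: indicator_def)
    then show ?thesis using zero[OF False] by simp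
  qed
  then show ?thesis unfolding int_span_def by blast
qed

lemma group_ring_mult_off:
  assumes "group G" "z \<notin> carrier G"
  shows "(f \<otimes>\<^bsub>group_ring G\<^esub> g) z = 0"
proof -
  interpret group G by fact
  have "{(x, y). x \<in> carrier G \<and> y \<in> carrier G \<and> x \<otimes>\<^bsub>G\<^esub> y = z} = {}" using assms(2) by auto
  then have "(\<Sum>(x, y)\<in>{(x, y). x \<in> carrier G \<and> y \<in> carrier G \<and> x \<otimes>\<^bsub>G\<^esub> y = z}. f x * g y) = 0"
    by (simp only: sum.empty)
  then show ?thesis by (simp add: group_ring_def)
qed

text \<open>
  Sums, negatives and the unit stay in the span for every partition with \<open>{\<one>}\<close> as a class. For
  the span to be a subring, it remains that the convolution of two functions that are constant on
  the classes is again constant on the classes.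
\<close>

lemma S_ring_int_span:
  assumes "group G" and fin: "finite (carrier G)" and part: "partition_on (carrier G) \<S>"
    and one: "{\<one>\<^bsub>G\<^esub>} \<in> \<S>"
    and inv: "\<And>X. X \<in> \<S> \<Longrightarrow> (\<lambda>x. inv\<^bsub>G\<^esub> x) ` X \<in> \<S>"
    and conv: "\<And>f g X x y. \<lbrakk>f \<in> int_span \<S>; g \<in> int_span \<S>; X \<in> \<S>; x \<in> X; y \<in> X\<rbrakk> \<Longrightarrow>
      (f \<otimes>\<^bsub>group_ring G\<^esub> g) x = (f \<otimes>\<^bsub>group_ring G\<^esub> g) y"
  shows "S_ring G (int_span \<S>)" "basic_sets G (int_span \<S>) = \<S>"
proof -
  interpret group G by fact
  interpret R: ring "group_ring G" using fin by (rule ring_group_ring)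
  have bp: "basic_partition G (int_span \<S>) \<S>"
    using part one inv by (auto simp: basic_partition_def)
  then show "basic_sets G (int_span \<S>) = \<S>" using fin by (rule basic_sets_eq[rotated])
  have carr: "int_span \<S> \<subseteq> carrier (group_ring G)"
    using int_span_zero[OF part] by (simp add: group_ring_def subset_iff)
  have "subring (int_span \<S>) (group_ring G)"
  proof (rule R.subringI)
    show "int_span \<S> \<subseteq> carrier (group_ring G)" by (fact carr)
    show "\<one>\<^bsub>group_ring G\<^esub> \<in> int_span \<S>"
      using indicator_in_int_span[OF finite_elements[OF fin part] one]
      by (simp add: group_ring_def)
    show "f \<otimes>\<^bsub>group_ring G\<^esub> g \<in> int_span \<S>" if "f \<in> int_span \<S>" "g \<in> int_span \<S>" for f g
    proof (rule int_spanI[OF fin part])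
      show "(f \<otimes>\<^bsub>group_ring G\<^esub> g) x = 0" if "x \<notin> carrier G" for x
        using \<open>group G\<close> that by (rule group_ring_mult_off)
    qed (rule conv[OF that])
    show "f \<oplus>\<^bsub>group_ring G\<^esub> g \<in> int_span \<S>" if "f \<in> int_span \<S>" "g \<in> int_span \<S>" for f g
    proof (rule int_spanI[OF fin part])
      show "(f \<oplus>\<^bsub>group_ring G\<^esub> g) x = 0" if "x \<notin> carrier G" for x
        using int_span_zero[OF part \<open>f \<in> int_span \<S>\<close> that]
          int_span_zero[OF part \<open>g \<in> int_span \<S>\<close> that] by (simp add: group_ring_def)
      show "(f \<oplus>\<^bsub>group_ring G\<^esub> g) x = (f \<oplus>\<^bsub>group_ring G\<^esub> g) y"
        if "X \<in> \<S>" "x \<in> X" "y \<in> X" for X x y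
        using int_span_const[OF fin part \<open>f \<in> int_span \<S>\<close> that]
          int_span_const[OF fin part \<open>g \<in> int_span \<S>\<close> that] by (simp add: group_ring_def)
    qed
    fix f assume f: "f \<in> int_span \<S>"
    have "\<ominus>\<^bsub>group_ring G\<^esub> f = (\<lambda>x. - f x)"
    proof (rule R.minus_equality)
      show "(\<lambda>x. - f x) \<oplus>\<^bsub>group_ring G\<^esub> f = \<zero>\<^bsub>group_ring G\<^esub>" by (simp add: group_ring_def)
      show "f \<in> carrier (group_ring G)" using f carr by auto
      show "(\<lambda>x. - f x) \<in> carrier (group_ring G)" using f carr by (auto simp: group_ring_def)
    qed
    moreover have "(\<lambda>x. - f x) \<in> int_span \<S>"
    proof (rule int_spanI[OF fin part])
      show "- f x = - f y" if "X \<in> \<S>" "x \<in> X" "y \<in> X" for X x y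
        using int_span_const[OF fin part f that] by simp
    qed (simp add: int_span_zero[OF part f])
    ultimately show "\<ominus>\<^bsub>group_ring G\<^esub> f \<in> int_span \<S>" by simp
  qed
  then show "S_ring G (int_span \<S>)" using bp fin \<open>group G\<close> by (auto simp: S_ring_def)
qed

lemma S_ringD:
  assumes "S_ring G \<A>"
  shows "group G" "finite (carrier G)" "partition_on (carrier G) (basic_sets G \<A>)"
    "{\<one>\<^bsub>G\<^esub>} \<in> basic_sets G \<A>" "\<A> = int_span (basic_sets G \<A>)"
    "\<And>X. X \<in> basic_sets G \<A> \<Longrightarrow> (\<lambda>x. inv\<^bsub>G\<^esub> x) ` X \<in> basic_sets G \<A>"
    "\<And>f g. f \<in> \<A> \<Longrightarrow> g \<in> \<A> \<Longrightarrow> f \<otimes>\<^bsub>group_ring G\<^esub> g \<in> \<A>"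
proof -
  obtain \<S> where S: "basic_partition G \<A> \<S>" and G: "group G" "finite (carrier G)"
    and sr: "subring \<A> (group_ring G)"
    using assms by (auto simp: S_ring_def)
  have bp: "basic_partition G \<A> (basic_sets G \<A>)" using basic_sets_eq[OF G(2) S] S by simp
  show "group G" "finite (carrier G)" by (fact G)+
  show "partition_on (carrier G) (basic_sets G \<A>)"
    using bp unfolding basic_partition_def by (elim conjE)
  show "{\<one>\<^bsub>G\<^esub>} \<in> basic_sets G \<A>"
    using bp unfolding basic_partition_def by (elim conjE)
  show "\<A> = int_span (basic_sets G \<A>)"
    using bp unfolding basic_partition_def by (elim conjE)
  show "(\<lambda>x. inv\<^bsub>G\<^esub> x) ` X \<in> basic_sets G \<A>" if "X \<in> basic_sets G \<A>" for X
    using bp that unfolding basic_partition_def by (elim conjE) (rule bspec)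
  interpret group G by fact
  show "f \<otimes>\<^bsub>group_ring G\<^esub> g \<in> \<A>" if "f \<in> \<A>" "g \<in> \<A>" for f g
    using subringE(6)[OF sr that] .
qed

lemma S_ring_memI:
  assumes "S_ring G \<A>" "\<And>x. x \<notin> carrier G \<Longrightarrow> f x = 0"
    and "\<And>X x y. \<lbrakk>X \<in> basic_sets G \<A>; x \<in> X; y \<in> X\<rbrakk> \<Longrightarrow> f x = f y"
  shows "f \<in> \<A>"
  by (subst S_ringD(5)[OF assms(1)]) (rule int_spanI[OF S_ringD(2,3)[OF assms(1)] assms(2,3)])

lemma S_ring_mem_const:
  assumes "S_ring G \<A>" "f \<in> \<A>" "X \<in> basic_sets G \<A>" "x \<in> X" "y \<in> X"
  shows "f x = f y"
  using int_span_const[OF S_ringD(2,3)[OF assms(1)] _ assms(3-5)] assms(2) S_ringD(5)[OF assms(1)]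
  by blast

lemma basic_set_subset_carrier:
  assumes "S_ring G \<A>" "X \<in> basic_sets G \<A>"
  shows "X \<subseteq> carrier G"
  using partition_onD1[OF S_ringD(3)[OF assms(1)]] assms(2) by auto

lemma basic_set_nonempty:
  assumes "S_ring G \<A>" "X \<in> basic_sets G \<A>"
  shows "X \<noteq> {}"
  using partition_onD3[OF S_ringD(3)[OF assms(1)]] assms(2) by auto

lemma basic_set_cover:
  assumes "S_ring G \<A>" "x \<in> carrier G"
  obtains X where "X \<in> basic_sets G \<A>" "x \<in> X"
  using partition_onD1[OF S_ringD(3)[OF assms(1)]] assms(2) by auto

lemma basic_set_eqI:
  assumes "S_ring G \<A>" "X \<in> basic_sets G \<A>" "Y \<in> basic_sets G \<A>" "x \<in> X" "x \<in> Y"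
  shows "X = Y"
  using partition_onD2[OF S_ringD(3)[OF assms(1)]] assms(2-) by (auto simp: disjoint_def)

lemma basic_set_subset:
  assumes "S_ring G \<A>" "indicator D \<in> \<A>" "X \<in> basic_sets G \<A>" "x \<in> X" "x \<in> D"
  shows "X \<subseteq> D"
proof
  fix y assume "y \<in> X"
  then have "indicator D x = (indicator D y :: int)"
    using S_ring_mem_const[OF assms(1-4)] by blast
  then show "y \<in> D" using assms(5) by (auto simp: indicator_def split: if_splits)
qed

section \<open>Unions of basic sets\<close>

text \<open>
  Membership of an indicator in the S-ring is the form in which ``union of basic sets'' is used
  below, because the ring operations act on it.
\<close>

lemma indicator_mem_iff:
  assumes S: "S_ring G \<A>" and D: "D \<subseteq> carrier G"
  shows "indicator D \<in> \<A> \<longleftrightarrow> (\<forall>X\<in>basic_sets G \<A>. X \<inter> D \<noteq> {} \<longrightarrow> X \<subseteq> D)"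
proof
  assume sat: "\<forall>X\<in>basic_sets G \<A>. X \<inter> D \<noteq> {} \<longrightarrow> X \<subseteq> D"
  show "indicator D \<in> \<A>"
  proof (rule S_ring_memI[OF S])
    fix X x y assume "X \<in> basic_sets G \<A>" "x \<in> X" "y \<in> X"
    then have "x \<in> D \<longleftrightarrow> y \<in> D" using sat by blast
    then show "indicator D x = (indicator D y :: int)" by (simp add: indicator_def)
  qed (use D in \<open>auto simp: indicator_def\<close>)
qed (use basic_set_subset[OF S] in blast)

lemma indicator_basic_set:
  assumes "S_ring G \<A>" "X \<in> basic_sets G \<A>"
  shows "indicator X \<in> \<A>"
  unfolding indicator_mem_iff[OF assms(1) basic_set_subset_carrier[OF assms]]
proof (intro ballI impI)
  fix Y assume Y: "Y \<in> basic_sets G \<A>" "Y \<inter> X \<noteq> {}"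
  then obtain y where "y \<in> Y" "y \<in> X" by blast
  then have "Y = X" by (rule basic_set_eqI[OF assms(1) Y(1) assms(2)])
  then show "Y \<subseteq> X" by simp
qed

lemma A_group_iff:
  assumes "S_ring G \<A>"
  shows "A_group G \<A> H \<longleftrightarrow> subgroup H G \<and> indicator H \<in> \<A>"
proof (cases "subgroup H G")
  case True
  then have H: "H \<subseteq> carrier G" by (rule subgroup.subset)
  have "(\<exists>\<X>. \<X> \<subseteq> basic_sets G \<A> \<and> H = \<Union>\<X>) \<longleftrightarrow> (\<forall>X\<in>basic_sets G \<A>. X \<inter> H \<noteq> {} \<longrightarrow> X \<subseteq> H)"
  proof
    show "\<forall>X\<in>basic_sets G \<A>. X \<inter> H \<noteq> {} \<longrightarrow> X \<subseteq> H"
      if ex: "\<exists>\<X>. \<X> \<subseteq> basic_sets G \<A> \<and> H = \<Union>\<X>"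
    proof (intro ballI impI)
      fix X assume X: "X \<in> basic_sets G \<A>" "X \<inter> H \<noteq> {}"
      obtain \<X> where \<X>: "\<X> \<subseteq> basic_sets G \<A>" "H = \<Union>\<X>" using ex by blast
      then obtain x Y where xY: "x \<in> X" "x \<in> Y" "Y \<in> \<X>" using X(2) by blast
      then have "X = Y" using \<X>(1) by (intro basic_set_eqI[OF assms X(1)]) auto
      then show "X \<subseteq> H" using \<X>(2) xY(3) by blast
    qed
    assume sat: "\<forall>X\<in>basic_sets G \<A>. X \<inter> H \<noteq> {} \<longrightarrow> X \<subseteq> H"
    have "H = \<Union>{X\<in>basic_sets G \<A>. X \<inter> H \<noteq> {}}"
    proof (intro equalityI subsetI)
      fix x assume "x \<in> H"
      moreover obtain X where "X \<in> basic_sets G \<A>" "x \<in> X"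
        using basic_set_cover[OF assms] H \<open>x \<in> H\<close> by blast
      ultimately show "x \<in> \<Union>{X\<in>basic_sets G \<A>. X \<inter> H \<noteq> {}}" by blast
    next
      fix x assume "x \<in> \<Union>{X\<in>basic_sets G \<A>. X \<inter> H \<noteq> {}}"
      then obtain X where "X \<in> basic_sets G \<A>" "X \<inter> H \<noteq> {}" "x \<in> X" by blast
      then show "x \<in> H" using sat by blast
    qed
    then show "\<exists>\<X>. \<X> \<subseteq> basic_sets G \<A> \<and> H = \<Union>\<X>"
      by (intro exI[of _ "{X\<in>basic_sets G \<A>. X \<inter> H \<noteq> {}}"] conjI Collect_restrict)
  qed
  then show ?thesis using True by (simp add: A_group_def indicator_mem_iff[OF assms H])
qed (simp add: A_group_def)

text \<open>
  The coefficient of the product of the two indicators at \<open>z\<close> counts the factorisations of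
  \<open>z\<close> in \<open>X \<cdot> Y\<close>. It is nonnegative, hence its support is all of \<open>X \<cdot> Y\<close>, and it is constant
  on basic sets, hence this support is a union of basic sets.
\<close>

lemma indicator_set_mult:
  assumes S: "S_ring G \<A>" and X: "X \<subseteq> carrier G" "indicator X \<in> \<A>" and Y: "Y \<subseteq> carrier G" "indicator Y \<in> \<A>"
  shows "indicator (X <#>\<^bsub>G\<^esub> Y) \<in> \<A>"
proof -
  interpret group G using S_ringD(1)[OF S] .
  let ?f = "indicator X \<otimes>\<^bsub>group_ring G\<^esub> indicator Y"
  have XY: "X <#>\<^bsub>G\<^esub> Y \<subseteq> carrier G" using X Y by (simp add: set_mult_closed)
  have f: "?f \<in> \<A>" using S_ringD(7)[OF S X(2) Y(2)] .
  have supp: "?f z \<noteq> 0 \<longleftrightarrow> z \<in> X <#>\<^bsub>G\<^esub> Y" if z: "z \<in> carrier G" for z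
  proof -
    have "?f z = 0 \<longleftrightarrow> (\<forall>x\<in>carrier G. indicator X x * indicator Y (inv\<^bsub>G\<^esub> x \<otimes>\<^bsub>G\<^esub> z) = (0::int))"
      unfolding group_ring_mult[OF z] using S_ringD(2)[OF S]
      by (subst sum_nonneg_eq_0_iff) (auto simp: indicator_def)
    also have "\<dots> \<longleftrightarrow> \<not> (\<exists>x\<in>X. inv\<^bsub>G\<^esub> x \<otimes>\<^bsub>G\<^esub> z \<in> Y)"
      using X by (auto simp: indicator_def)
    also have "(\<exists>x\<in>X. inv\<^bsub>G\<^esub> x \<otimes>\<^bsub>G\<^esub> z \<in> Y) \<longleftrightarrow> z \<in> X <#>\<^bsub>G\<^esub> Y"
    proof
      assume "\<exists>x\<in>X. inv\<^bsub>G\<^esub> x \<otimes>\<^bsub>G\<^esub> z \<in> Y"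
      then obtain x where x: "x \<in> X" "inv\<^bsub>G\<^esub> x \<otimes>\<^bsub>G\<^esub> z \<in> Y" by auto
      moreover have "z = x \<otimes>\<^bsub>G\<^esub> (inv\<^bsub>G\<^esub> x \<otimes>\<^bsub>G\<^esub> z)" using x(1) X z by (auto simp flip: m_assoc)
      ultimately show "z \<in> X <#>\<^bsub>G\<^esub> Y" unfolding set_mult_def by blast
    next
      assume "z \<in> X <#>\<^bsub>G\<^esub> Y"
      then obtain x y where xy: "x \<in> X" "y \<in> Y" "z = x \<otimes>\<^bsub>G\<^esub> y" by (auto simp: set_mult_def)
      then have "inv\<^bsub>G\<^esub> x \<otimes>\<^bsub>G\<^esub> z = y" using X(1) Y(1) by (auto simp: subset_iff simp flip: m_assoc)
      then show "\<exists>x\<in>X. inv\<^bsub>G\<^esub> x \<otimes>\<^bsub>G\<^esub> z \<in> Y" using xy(1,2) by blast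
    qed
    finally show ?thesis by blast
  qed
  show ?thesis
  proof (intro indicator_mem_iff[OF S XY, THEN iffD2] ballI impI subsetI)
    fix Z z assume Z: "Z \<in> basic_sets G \<A>" "Z \<inter> (X <#>\<^bsub>G\<^esub> Y) \<noteq> {}" "z \<in> Z"
    then obtain w where w: "w \<in> Z" "w \<in> X <#>\<^bsub>G\<^esub> Y" by blast
    have "w \<in> carrier G" "z \<in> carrier G" using basic_set_subset_carrier[OF S Z(1)] Z(3) w(1) by auto
    moreover have "?f w = ?f z" using f by (rule S_ring_mem_const[OF S _ Z(1) w(1) Z(3)])
    ultimately show "z \<in> X <#>\<^bsub>G\<^esub> Y" using supp[of w] supp[of z] w(2) by simp
  qed
qed

section \<open>Cosets, homomorphisms and cyclic groups\<close>

lemma (in group) coset_repr: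
  assumes "subgroup H G" "X \<in> rcosets H" "x \<in> X"
  shows "X = H #> x"
  using assms repr_independence[OF _ _ assms(1)] by (auto simp: RCOSETS_def)

lemma (in group_hom) hom_image_coset:
  assumes "subgroup J G" "X \<in> rcosets\<^bsub>G\<^esub> J"
  shows "subgroup (h ` J) H" "h ` X \<in> rcosets\<^bsub>H\<^esub> (h ` J)"
proof -
  show "subgroup (h ` J) H" using assms(1) by (rule subgroup_img_is_subgroup)
  obtain x where x: "x \<in> carrier G" "X = J #>\<^bsub>G\<^esub> x" using assms(2) by (auto simp: RCOSETS_def)
  have "h ` X = h ` J #>\<^bsub>H\<^esub> h x"
    using subgroup.mem_carrier[OF assms(1)] x by (force simp: r_coset_def image_iff)
  then show "h ` X \<in> rcosets\<^bsub>H\<^esub> (h ` J)" using x(1) by (auto simp: RCOSETS_def)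
qed

text \<open>
  If \<open>X\<close> is saturated for \<open>h\<close>, it is the full preimage of its image, and the full preimage of a
  coset of \<open>J\<close> is a coset of the preimage of \<open>J\<close>. This carries cosets back from a section.
\<close>

lemma (in group_hom) hom_preimage_coset:
  assumes J: "subgroup J H" and X: "X \<subseteq> carrier G" "h ` X \<in> rcosets\<^bsub>H\<^esub> J"
    and sat: "\<And>x y. \<lbrakk>x \<in> X; y \<in> carrier G; h y = h x\<rbrakk> \<Longrightarrow> y \<in> X"
  shows "\<exists>K. subgroup K G \<and> X \<in> rcosets\<^bsub>G\<^esub> K"
proof (intro exI conjI)
  let ?K = "{y \<in> carrier G. h y \<in> J}"
  interpret J: subgroup J H by fact
  show "subgroup ?K G" by (rule G.subgroupI) (auto intro!: exI[of _ "\<one>\<^bsub>G\<^esub>"])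
  have "h ` X \<noteq> {}" using X(2) subgroup.rcosets_non_empty[OF J] by auto
  then obtain x where x: "x \<in> X" by auto
  then have xG: "x \<in> carrier G" using X by auto
  have hX: "h ` X = J #>\<^bsub>H\<^esub> h x" using H.coset_repr[OF J X(2)] x by auto
  have "X = ?K #>\<^bsub>G\<^esub> x"
  proof (intro equalityI subsetI)
    fix y assume y: "y \<in> X"
    then have yG: "y \<in> carrier G" using X by auto
    have "h y \<in> J #>\<^bsub>H\<^esub> h x" using y hX by auto
    then obtain j where j: "j \<in> J" "h y = j \<otimes>\<^bsub>H\<^esub> h x" by (auto simp: r_coset_def)
    then have "h (y \<otimes>\<^bsub>G\<^esub> inv\<^bsub>G\<^esub> x) = j" using xG yG by (simp add: H.m_assoc)
    then have "y \<otimes>\<^bsub>G\<^esub> inv\<^bsub>G\<^esub> x \<in> ?K" using j xG yG by auto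
    moreover have "y = (y \<otimes>\<^bsub>G\<^esub> inv\<^bsub>G\<^esub> x) \<otimes>\<^bsub>G\<^esub> x" using xG yG by (simp add: G.m_assoc)
    ultimately show "y \<in> ?K #>\<^bsub>G\<^esub> x" unfolding r_coset_def by blast
  next
    fix y assume "y \<in> ?K #>\<^bsub>G\<^esub> x"
    then obtain k where k: "k \<in> carrier G" "h k \<in> J" "y = k \<otimes>\<^bsub>G\<^esub> x" by (auto simp: r_coset_def)
    then have "h y \<in> h ` X" using xG unfolding hX by (auto simp: r_coset_def)
    then show "y \<in> X" using sat k xG by auto
  qed
  then show "X \<in> rcosets\<^bsub>G\<^esub> ?K" using xG by (auto simp: RCOSETS_def)
qed

text \<open>
  With \<open>d\<close> the least positive exponent of the generator that falls into \<open>U\<close>, the map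
  \<open>y \<mapsto> y^d\<close> is a homomorphism, since the group is abelian, and its image is exactly \<open>U\<close>; thus \<open>U\<close>
  is an epimorphic image of a cyclic group.
\<close>

lemma (in group) cyclic_group_subgroup:
  assumes "cyclic_group G" "finite (carrier G)" "subgroup U G"
  shows "cyclic_group (G\<lparr>carrier := U\<rparr>)"
proof -
  interpret comm_group G using assms(1) by (rule cyclic_imp_abelian_group)
  interpret U: subgroup U G by fact
  obtain x where x: "x \<in> carrier G" "carrier G = range (\<lambda>n::int. x [^] n)"
    using assms(1) cyclic_group by auto
  define d where "d = (LEAST d::nat. 0 < d \<and> x [^] d \<in> U)"
  have "0 < d \<and> x [^] d \<in> U" unfolding d_def
  proof (rule LeastI)
    show "0 < order G \<and> x [^] order G \<in> U"
      using assms(2) x(1) by (simp add: order_gt_0_iff_finite pow_order_eq_1)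
  qed
  then have d: "0 < d" "x [^] d \<in> U" by auto
  have dvd: "int d dvd i" if i: "x [^] i \<in> U" for i
  proof -
    \<comment> \<open>The remainder is a smaller exponent leading into \<open>U\<close>; by minimality of \<open>d\<close> it vanishes.\<close>
    define r where "r = nat (i mod int d)"
    have r: "int r = i mod int d" "r < d" using d(1) by (simp_all add: r_def nat_less_iff)
    have "i - int d * (i div int d) = int r" using r by (simp add: minus_mult_div_eq_mod)
    then have "x [^] int r = x [^] i \<otimes> inv ((x [^] d) [^] (i div int d))"
      using x(1) by (metis int_pow_diff int_pow_int int_pow_pow)
    also have "\<dots> \<in> U" using i d(2) by (simp add: subgroup_int_pow_closed[OF assms(3)])
    finally have "x [^] r \<in> U" by (simp add: int_pow_int)
    then have "r = 0" using not_less_Least[of r "\<lambda>d. 0 < d \<and> x [^] d \<in> U"] r(2) by (auto simp: d_def)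
    then show ?thesis using r(1) by (simp add: dvd_eq_mod_eq_0)
  qed
  have "(\<lambda>y. y [^] d) ` carrier G = U"
  proof (intro equalityI subsetI)
    fix y assume "y \<in> (\<lambda>y. y [^] d) ` carrier G"
    then obtain i :: int where "y = (x [^] i) [^] d" using x(2) by auto
    then have "y = (x [^] d) [^] i" using x(1) by (metis int_pow_int int_pow_pow mult.commute)
    then show "y \<in> U" using d(2) subgroup_int_pow_closed[OF assms(3)] by auto
  next
    fix y assume y: "y \<in> U"
    then obtain i :: int where i: "y = x [^] i" using x(2) U.subset by blast
    then obtain j where "i = j * int d" using dvd y by (metis dvdE mult.commute)
    then have "y = (x [^] j) [^] d" using i x(1) by (metis int_pow_int int_pow_pow)
    then show "y \<in> (\<lambda>y. y [^] d) ` carrier G" using x(1) by auto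
  qed
  then have "(\<lambda>y. y [^] d) \<in> epi G (G\<lparr>carrier := U\<rparr>)"
    by (auto simp: epi_def hom_def nat_pow_distrib)
  then show ?thesis
    using assms by (intro cyclic_group_epimorphic_image[of "\<lambda>y. y [^] d" "G\<lparr>carrier := U\<rparr>"])
      (auto intro: subgroup_imp_group)
qed

section \<open>The S-ring over a section\<close>

lemma section_group_hom:
  assumes G: "group G" and U: "subgroup U G" and L: "L \<lhd> G\<lparr>carrier := U\<rparr>"
  shows "group_hom (G\<lparr>carrier := U\<rparr>) (section_group G U L) (\<lambda>x. L #>\<^bsub>G\<^esub> x)"
    and "(\<lambda>x. L #>\<^bsub>G\<^esub> x) ` U = carrier (section_group G U L)"
proof -
  interpret group G by fact
  interpret L: normal L "G\<lparr>carrier := U\<rparr>" by fact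
  have "group (section_group G U L)" unfolding section_group_def by (rule L.factorgroup_is_group)
  moreover have "(\<lambda>x. L #>\<^bsub>G\<^esub> x) \<in> hom (G\<lparr>carrier := U\<rparr>) (section_group G U L)"
    using L.r_coset_hom_Mod by (simp add: section_group_def)
  ultimately show "group_hom (G\<lparr>carrier := U\<rparr>) (section_group G U L) (\<lambda>x. L #>\<^bsub>G\<^esub> x)"
    by (intro group_hom.intro group_hom_axioms.intro L.is_group)
  show "(\<lambda>x. L #>\<^bsub>G\<^esub> x) ` U = carrier (section_group G U L)"
    by (simp add: section_group_def carrier_FactGroup)
qed

lemma A_sectionD:
  assumes "S_ring G \<A>" "A_section G \<A> U L"
  shows "subgroup U G" "indicator U \<in> \<A>" "subgroup L G" "indicator L \<in> \<A>"
    "L \<lhd> G\<lparr>carrier := U\<rparr>"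
  using assms(2) unfolding A_section_def A_group_iff[OF assms(1)] by simp_all

lemma (in group) rcoset_eq_iff:
  assumes "subgroup L G" "x \<in> carrier G" "y \<in> carrier G"
  shows "L #> x = L #> y \<longleftrightarrow> y \<in> L #> x"
  using assms repr_independence rcos_self by metis

text \<open>
  The product \<open>L \<cdot> X\<close> is a union of basic sets. If a coset of \<open>L\<close> meets both \<open>X\<close> and \<open>Y\<close>, then
  \<open>Y\<close> meets \<open>L \<cdot> X\<close> and is therefore contained in it. This is why the images of basic sets
  in a section are equal or disjoint.
\<close>

lemma rcosets_image_overlap:
  assumes S: "S_ring G \<A>" and L: "subgroup L G" "indicator L \<in> \<A>"
    and X: "X \<in> basic_sets G \<A>" and Y: "Y \<in> basic_sets G \<A>"
    and xy: "x \<in> X" "y \<in> Y" "L #>\<^bsub>G\<^esub> x = L #>\<^bsub>G\<^esub> y"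
  shows "(\<lambda>x. L #>\<^bsub>G\<^esub> x) ` Y \<subseteq> (\<lambda>x. L #>\<^bsub>G\<^esub> x) ` X"
proof
  interpret group G using S_ringD(1)[OF S] .
  have XG: "X \<subseteq> carrier G" and YG: "Y \<subseteq> carrier G"
    using basic_set_subset_carrier[OF S] X Y by auto
  have "y \<in> L #>\<^bsub>G\<^esub> x" using rcoset_eq_iff[OF L(1)] xy XG YG by blast
  then have "y \<in> L <#>\<^bsub>G\<^esub> X" using xy(1) by (auto simp: r_coset_def set_mult_def)
  moreover have "indicator (L <#>\<^bsub>G\<^esub> X) \<in> \<A>"
    using indicator_set_mult[OF S subgroup.subset[OF L(1)] L(2) XG indicator_basic_set[OF S X]] .
  ultimately have sub: "Y \<subseteq> L <#>\<^bsub>G\<^esub> X" using basic_set_subset[OF S _ Y xy(2)] by blast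
  fix a assume "a \<in> (\<lambda>x. L #>\<^bsub>G\<^esub> x) ` Y"
  then obtain y' where y': "y' \<in> Y" "a = L #>\<^bsub>G\<^esub> y'" by auto
  then obtain l x' where "l \<in> L" "x' \<in> X" "y' = l \<otimes>\<^bsub>G\<^esub> x'" using sub by (auto simp: set_mult_def)
  then have "y' \<in> L #>\<^bsub>G\<^esub> x'" by (auto simp: r_coset_def)
  then have "L #>\<^bsub>G\<^esub> x' = a"
    using rcoset_eq_iff[OF L(1), of x' y'] \<open>x' \<in> X\<close> y' XG YG by blast
  then show "a \<in> (\<lambda>x. L #>\<^bsub>G\<^esub> x) ` X" using \<open>x' \<in> X\<close> by auto
qed

text \<open>
  A function on \<open>U/L\<close> can be lifted to one on \<open>G\<close> by composing it with the quotient map and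
  putting zero off \<open>U\<close>. The lift is multiplicative up to the factor \<open>card L\<close>: the summand of the
  convolution upstairs depends only on the coset of \<open>x\<close>, and every coset has \<open>card L\<close> elements.
\<close>

lemma group_ring_mult_section:
  assumes G: "group G" and fin: "finite (carrier G)" and U: "subgroup U G"
    and L: "L \<lhd> G\<lparr>carrier := U\<rparr>" and z: "z \<in> U"
  shows "((\<lambda>x. if x \<in> U then f (L #>\<^bsub>G\<^esub> x) else 0) \<otimes>\<^bsub>group_ring G\<^esub>
           (\<lambda>x. if x \<in> U then g (L #>\<^bsub>G\<^esub> x) else 0)) z =
         int (card L) * (f \<otimes>\<^bsub>group_ring (section_group G U L)\<^esub> g) (L #>\<^bsub>G\<^esub> z)"
    (is "(?F \<otimes>\<^bsub>_\<^esub> ?K) z = _")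
proof -
  interpret group G by fact
  interpret U: subgroup U G by fact
  let ?Q = "section_group G U L" and ?\<pi> = "\<lambda>x. L #>\<^bsub>G\<^esub> x"
  interpret \<pi>: group_hom "G\<lparr>carrier := U\<rparr>" ?Q ?\<pi> using section_group_hom(1)[OF G U L] .
  have img: "?\<pi> ` U = carrier ?Q" using section_group_hom(2)[OF G U L] .
  have LU: "L \<subseteq> U" using subgroup.subset[OF normal_imp_subgroup[OF L]] by simp
  have LG: "subgroup L G" using incl_subgroup[OF U normal_imp_subgroup[OF L]] .
  have zG: "z \<in> carrier G" using z U.subset by auto
  have finU: "finite U" using U.subset fin by (rule finite_subset)
  have piz: "?\<pi> z \<in> carrier ?Q" using z img by blast
  let ?h = "\<lambda>a. f a * g (inv\<^bsub>?Q\<^esub> a \<otimes>\<^bsub>?Q\<^esub> ?\<pi> z)"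
  \<comment> \<open>The inner argument of the second factor depends only on the coset of \<open>x\<close>, too.\<close>
  have hom: "?\<pi> (inv\<^bsub>G\<^esub> x \<otimes>\<^bsub>G\<^esub> z) = inv\<^bsub>?Q\<^esub> (?\<pi> x) \<otimes>\<^bsub>?Q\<^esub> ?\<pi> z" if "x \<in> U" for x
    using that z \<pi>.hom_mult[of "inv\<^bsub>G\<^esub> x" z] \<pi>.hom_inv[of x] m_inv_consistent[OF U that] by simp
  have fib: "card {x \<in> U. ?\<pi> x = a} = card L" if a: "a \<in> carrier ?Q" for a
  proof -
    obtain u where u: "u \<in> U" "a = ?\<pi> u" using a img by blast
    have uG: "u \<in> carrier G" using u U.subset by auto
    have "{x \<in> U. ?\<pi> x = a} = a"
    proof (intro equalityI subsetI)
      fix x assume x: "x \<in> {x \<in> U. ?\<pi> x = a}"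
      then have "?\<pi> u = ?\<pi> x" using u(2) by simp
      then show "x \<in> a" using rcoset_eq_iff[OF LG uG, of x] x U.subset u(2) by blast
    next
      fix x assume x: "x \<in> a"
      then have "x \<in> U" using u LU U.m_closed by (auto simp: r_coset_def)
      moreover have "?\<pi> u = ?\<pi> x"
        using rcoset_eq_iff[OF LG uG, of x] x \<open>x \<in> U\<close> U.subset u(2) by blast
      ultimately show "x \<in> {x \<in> U. ?\<pi> x = a}" using u(2) by simp
    qed
    moreover have "a \<in> rcosets\<^bsub>G\<^esub> L" using u uG by (auto simp: RCOSETS_def)
    ultimately show ?thesis using card_rcosets_equal[OF _ subgroup.subset[OF LG], of a] by simp
  qed
  have "(?F \<otimes>\<^bsub>group_ring G\<^esub> ?K) z = (\<Sum>x\<in>carrier G. ?F x * ?K (inv\<^bsub>G\<^esub> x \<otimes>\<^bsub>G\<^esub> z))"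
    by (rule group_ring_mult[OF zG])
  also have "\<dots> = (\<Sum>x\<in>U. ?h (?\<pi> x))"
    by (rule sum.mono_neutral_cong_right[OF fin U.subset])
      (use z in \<open>simp_all add: hom\<close>)
  also have "\<dots> = (\<Sum>a\<in>carrier ?Q. int (card {x \<in> U. ?\<pi> x = a}) * ?h a)"
    by (rule sum_fun_comp[OF finU _ eq_refl[OF img]]) (use finU in \<open>simp flip: img\<close>)
  also have "\<dots> = (\<Sum>a\<in>carrier ?Q. int (card L) * ?h a)"
    by (intro sum.cong) (simp_all add: fib)
  also have "\<dots> = int (card L) * (f \<otimes>\<^bsub>group_ring ?Q\<^esub> g) (?\<pi> z)"
    by (simp add: \<pi>.H.group_ring_mult[OF piz] sum_distrib_left)
  finally show ?thesis .
qed

text \<open>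
  A function on the section that is constant on the image classes lifts to an element of
  \<open>\<A>\<close>. So the product of two lifts lies in \<open>\<A>\<close>, and after division by \<open>card L\<close> the
  product on the section is constant on the image classes.
\<close>

lemma S_ring_section:
  assumes S: "S_ring G \<A>" and sec: "A_section G \<A> U L"
  shows "S_ring (section_group G U L) (section_S_ring G \<A> U L)"
    and "basic_sets (section_group G U L) (section_S_ring G \<A> U L) =
      {(\<lambda>x. L #>\<^bsub>G\<^esub> x) ` X | X. X \<in> basic_sets G \<A> \<and> X \<subseteq> U}"
proof -
  let ?Q = "section_group G U L" and ?\<pi> = "\<lambda>x. L #>\<^bsub>G\<^esub> x"
  let ?T = "{?\<pi> ` X | X. X \<in> basic_sets G \<A> \<and> X \<subseteq> U}"
  note sr = S_ringD[OF S]
  note U = A_sectionD(1,2)[OF S sec] and L = A_sectionD(3-5)[OF S sec]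
  interpret group G using sr(1) .
  interpret U: subgroup U G using U(1) .
  interpret \<pi>: group_hom "G\<lparr>carrier := U\<rparr>" ?Q ?\<pi> using section_group_hom(1)[OF sr(1) U(1) L(3)] .
  have img: "?\<pi> ` U = carrier ?Q" using section_group_hom(2)[OF sr(1) U(1) L(3)] .
  have finQ: "finite (carrier ?Q)" using finite_subset[OF U.subset sr(2)] by (simp flip: img)
  have inU: "X \<subseteq> U" if "X \<in> basic_sets G \<A>" "x \<in> X" "x \<in> U" for X x
    using basic_set_subset[OF S U(2) that] .
  have part: "partition_on (carrier ?Q) ?T"
  proof (rule partition_onI)
    show "\<Union>?T = carrier ?Q"
    proof (intro equalityI subsetI)
      fix a assume "a \<in> carrier ?Q"
      then obtain x where x: "x \<in> U" "a = ?\<pi> x" using img by blast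
      obtain X where X: "X \<in> basic_sets G \<A>" "x \<in> X" using basic_set_cover[OF S] x(1) U.subset by blast
      then show "a \<in> \<Union>?T" using inU[OF X x(1)] x(2) by blast
    qed (use img in blast)
    show "{} \<notin> ?T" using basic_set_nonempty[OF S] by blast
    fix p q assume "p \<in> ?T" "q \<in> ?T" "p \<noteq> q"
    then obtain X Y where XY: "X \<in> basic_sets G \<A>" "Y \<in> basic_sets G \<A>" "p = ?\<pi> ` X" "q = ?\<pi> ` Y"
      by blast
    show "disjnt p q"
    proof (rule ccontr)
      assume "\<not> disjnt p q"
      then obtain x y where xy: "x \<in> X" "y \<in> Y" "?\<pi> x = ?\<pi> y" using XY by (auto simp: disjnt_iff)
      have "p = q" unfolding XY(3,4)
        using rcosets_image_overlap[OF S L(1,2) XY(1,2) xy]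
          rcosets_image_overlap[OF S L(1,2) XY(2,1) xy(2,1) xy(3)[symmetric]] by (rule equalityI[rotated])
      then show False using \<open>p \<noteq> q\<close> by simp
    qed
  qed
  have one: "{\<one>\<^bsub>?Q\<^esub>} \<in> ?T"
    using sr(4) U.one_closed \<pi>.hom_one by (intro CollectI exI[of _ "{\<one>\<^bsub>G\<^esub>}"]) simp
  have inv: "(\<lambda>a. inv\<^bsub>?Q\<^esub> a) ` P \<in> ?T" if P: "P \<in> ?T" for P
  proof -
    obtain X where X: "X \<in> basic_sets G \<A>" "X \<subseteq> U" "P = ?\<pi> ` X" using P by blast
    have "inv\<^bsub>?Q\<^esub> (?\<pi> x) = ?\<pi> (inv\<^bsub>G\<^esub> x)" if "x \<in> X" for x
      using \<pi>.hom_inv[of x] m_inv_consistent[OF U(1), of x] X(2) that by auto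
    then have "(\<lambda>a. inv\<^bsub>?Q\<^esub> a) ` P = ?\<pi> ` ((\<lambda>x. inv\<^bsub>G\<^esub> x) ` X)"
      unfolding X(3) image_image by (intro image_cong) auto
    moreover have "(\<lambda>x. inv\<^bsub>G\<^esub> x) ` X \<subseteq> U" using X(2) by auto
    ultimately show ?thesis using sr(6)[OF X(1)] by blast
  qed
  have lift: "(\<lambda>x. if x \<in> U then f (?\<pi> x) else 0) \<in> \<A>" if f: "f \<in> int_span ?T" for f
  proof (rule S_ring_memI[OF S])
    fix X x y assume X: "X \<in> basic_sets G \<A>" "x \<in> X" "y \<in> X"
    show "(if x \<in> U then f (?\<pi> x) else 0) = (if y \<in> U then f (?\<pi> y) else 0)"
    proof (cases "X \<subseteq> U")
      case True
      then have "?\<pi> ` X \<in> ?T" using X(1) by blast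
      then have "f (?\<pi> x) = f (?\<pi> y)"
        using X by (intro int_span_const[OF finQ part f]) auto
      then show ?thesis using X True by auto
    next
      case False
      then have "x \<notin> U" "y \<notin> U" using inU X by blast+
      then show ?thesis by simp
    qed
  qed (use U.subset in auto)
  have conv: "(f \<otimes>\<^bsub>group_ring ?Q\<^esub> g) a = (f \<otimes>\<^bsub>group_ring ?Q\<^esub> g) b"
    if f: "f \<in> int_span ?T" and g: "g \<in> int_span ?T" and P: "P \<in> ?T" "a \<in> P" "b \<in> P" for f g P a b
  proof -
    let ?F = "\<lambda>x. if x \<in> U then f (?\<pi> x) else 0" and ?K = "\<lambda>x. if x \<in> U then g (?\<pi> x) else 0"
    obtain X where X: "X \<in> basic_sets G \<A>" "X \<subseteq> U" "P = ?\<pi> ` X" using P(1) by blast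
    obtain x y where x: "x \<in> X" "a = ?\<pi> x" and y: "y \<in> X" "b = ?\<pi> y" using P(2,3) unfolding X(3) by blast
    have "(?F \<otimes>\<^bsub>group_ring G\<^esub> ?K) x = (?F \<otimes>\<^bsub>group_ring G\<^esub> ?K) y"
      by (rule S_ring_mem_const[OF S sr(7)[OF lift[OF f] lift[OF g]] X(1) x(1) y(1)])
    moreover have "x \<in> U" "y \<in> U" using x y X(2) by auto
    ultimately have "int (card L) * (f \<otimes>\<^bsub>group_ring ?Q\<^esub> g) a = int (card L) * (f \<otimes>\<^bsub>group_ring ?Q\<^esub> g) b"
      by (simp only: group_ring_mult_section[OF sr(1,2) U(1) L(3)] x(2) y(2))
    moreover have "card L \<noteq> 0"
      using finite_subset[OF subgroup.subset[OF L(1)] sr(2)] subgroup.one_closed[OF L(1)] by auto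
    ultimately show ?thesis by simp
  qed
  show "S_ring ?Q (section_S_ring G \<A> U L)" "basic_sets ?Q (section_S_ring G \<A> U L) = ?T"
    unfolding section_S_ring_def
    by (rule S_ring_int_span[OF \<pi>.H.is_group finQ part one inv conv]; assumption)+
qed

lemma cyclic_section_group:
  assumes "cyclic_group G" "group G" "finite (carrier G)" "subgroup U G" "L \<lhd> G\<lparr>carrier := U\<rparr>"
  shows "cyclic_group (section_group G U L)"
proof -
  interpret \<pi>: group_hom "G\<lparr>carrier := U\<rparr>" "section_group G U L" "\<lambda>x. L #>\<^bsub>G\<^esub> x"
    using section_group_hom(1)[OF assms(2,4,5)] .
  have "(\<lambda>x. L #>\<^bsub>G\<^esub> x) \<in> epi (G\<lparr>carrier := U\<rparr>) (section_group G U L)"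
    using \<pi>.homh section_group_hom(2)[OF assms(2,4,5)] by (simp add: epi_def)
  then show ?thesis
    using \<pi>.G.cyclic_group_epimorphic_image group.cyclic_group_subgroup[OF assms(2,1,3,4)]
      \<pi>.H.is_group by blast
qed

section \<open>Cosets in sections and generalized wreath products\<close>

text \<open>
  The subgroup is contained in \<open>U\<close>, because it consists of quotients of elements of \<open>X\<close>.
\<close>

lemma (in group) coset_in_subgroup:
  assumes U: "subgroup U G" and J: "subgroup J G" and X: "X \<in> rcosets J" "X \<subseteq> U" "X \<noteq> {}"
  shows "subgroup J (G\<lparr>carrier := U\<rparr>)" "X \<in> rcosets\<^bsub>G\<lparr>carrier := U\<rparr>\<^esub> J"
proof -
  interpret U: subgroup U G by fact
  interpret J: subgroup J G by fact
  obtain x where x: "x \<in> X" using X(3) by blast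
  have Xx: "X = J #> x" using coset_repr[OF J X(1) x] .
  have xU: "x \<in> U" using x X(2) by blast
  have "J \<subseteq> U"
  proof
    fix j assume j: "j \<in> J"
    then have "j \<otimes> x \<in> U" using Xx X(2) by (auto simp: r_coset_def)
    then have "(j \<otimes> x) \<otimes> inv x \<in> U" using xU by simp
    then show "j \<in> U" using j xU by (simp add: m_assoc)
  qed
  then show "subgroup J (G\<lparr>carrier := U\<rparr>)" using U J by (intro subgroup_incl)
  show "X \<in> rcosets\<^bsub>G\<lparr>carrier := U\<rparr>\<^esub> J" using Xx xU by (auto simp: RCOSETS_def)
qed

lemma coset_S_ring_section:
  assumes C: "coset_S_ring G \<A>" and cyc: "cyclic_group G" and sec: "A_section G \<A> U L"
  shows "coset_S_ring (section_group G U L) (section_S_ring G \<A> U L)"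
    and "cyclic_group (section_group G U L)"
proof -
  let ?Q = "section_group G U L" and ?\<pi> = "\<lambda>x. L #>\<^bsub>G\<^esub> x"
  have S: "S_ring G \<A>" using C by (simp add: coset_S_ring_def)
  note sr = S_ringD[OF S]
  note U = A_sectionD(1,2)[OF S sec] and L = A_sectionD(3-5)[OF S sec]
  interpret group G using sr(1) .
  interpret \<pi>: group_hom "G\<lparr>carrier := U\<rparr>" ?Q ?\<pi> using section_group_hom(1)[OF sr(1) U(1) L(3)] .
  show cycQ: "cyclic_group ?Q" using cyclic_section_group[OF cyc sr(1,2) U(1) L(3)] .
  have "\<exists>H. subgroup H ?Q \<and> P \<in> rcosets\<^bsub>?Q\<^esub> H"
    if "P \<in> basic_sets ?Q (section_S_ring G \<A> U L)" for P
  proof -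
    obtain X where X: "X \<in> basic_sets G \<A>" "X \<subseteq> U" "P = ?\<pi> ` X"
      using \<open>P \<in> _\<close> unfolding S_ring_section(2)[OF S sec] by blast
    obtain J where J: "subgroup J G" "X \<in> rcosets\<^bsub>G\<^esub> J"
      using C X(1) unfolding coset_S_ring_def by blast
    show ?thesis
      using \<pi>.hom_image_coset[OF coset_in_subgroup[OF U(1) J X(2) basic_set_nonempty[OF S X(1)]]]
      unfolding X(3) by blast
  qed
  then show "coset_S_ring ?Q (section_S_ring G \<A> U L)"
    using S_ring_section(1)[OF S sec] \<pi>.H.cyclic_imp_abelian_group[OF cycQ]
    by (simp add: coset_S_ring_def)
qed

text \<open>
  A converse to the image statement: a basic set that is a union of cosets of \<open>L\<close> is the full
  preimage of its image in the section, so it is a coset as soon as the image is one.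
\<close>

lemma coset_from_section:
  assumes S: "S_ring G \<A>" and sec: "A_section G \<A> U L"
    and C: "coset_S_ring (section_group G U L) (section_S_ring G \<A> U L)"
    and X: "X \<in> basic_sets G \<A>" "X \<subseteq> U"
    and sat: "\<And>l x. \<lbrakk>l \<in> L; x \<in> X\<rbrakk> \<Longrightarrow> l \<otimes>\<^bsub>G\<^esub> x \<in> X"
  shows "\<exists>H. subgroup H G \<and> X \<in> rcosets\<^bsub>G\<^esub> H"
proof -
  let ?K = "G\<lparr>carrier := U\<rparr>" and ?Q = "section_group G U L" and ?\<pi> = "\<lambda>x. L #>\<^bsub>G\<^esub> x"
  note sr = S_ringD[OF S]
  note U = A_sectionD(1,2)[OF S sec] and L = A_sectionD(3-5)[OF S sec]
  interpret group G using sr(1) .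
  interpret U: subgroup U G using U(1) .
  interpret \<pi>: group_hom ?K ?Q ?\<pi> using section_group_hom(1)[OF sr(1) U(1) L(3)] .
  have "?\<pi> ` X \<in> basic_sets ?Q (section_S_ring G \<A> U L)"
    unfolding S_ring_section(2)[OF S sec] using X by blast
  then obtain J where J: "subgroup J ?Q" "?\<pi> ` X \<in> rcosets\<^bsub>?Q\<^esub> J"
    using C unfolding coset_S_ring_def by blast
  have "\<exists>K. subgroup K ?K \<and> X \<in> rcosets\<^bsub>?K\<^esub> K"
  proof (rule \<pi>.hom_preimage_coset[OF J(1) _ J(2)])
    show "X \<subseteq> carrier ?K" using X(2) by simp
    fix x y assume xy: "x \<in> X" "y \<in> carrier ?K" "?\<pi> y = ?\<pi> x"
    then have "x \<in> carrier G" "y \<in> carrier G" using X(2) U.subset by auto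
    then have "y \<in> L #>\<^bsub>G\<^esub> x" using rcoset_eq_iff[OF L(1), of x y] xy(3) by metis
    then show "y \<in> X" using sat[OF _ xy(1)] by (auto simp: r_coset_def)
  qed
  then obtain K where K: "subgroup K ?K" "X \<in> rcosets\<^bsub>?K\<^esub> K" by blast
  have "subgroup K G" using incl_subgroup[OF U(1) K(1)] .
  moreover have "X \<in> rcosets\<^bsub>G\<^esub> K" using K(2) U.subset by (auto simp: RCOSETS_def)
  ultimately show ?thesis by blast
qed

text \<open>
  Each basic set is a full preimage from one of the two sections: from \<open>U/1\<close> if it lies inside
  \<open>U\<close>, and from \<open>G/L\<close> if it lies outside, since then it is invariant under \<open>L\<close>.
\<close>

lemma coset_S_ring_gen_wreath:
  assumes circ: "circulant_S_ring G \<A>" and wr: "gen_wreath G \<A> U L"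
    and CU: "coset_S_ring (section_group G U {\<one>\<^bsub>G\<^esub>}) (section_S_ring G \<A> U {\<one>\<^bsub>G\<^esub>})"
    and CQ: "coset_S_ring (section_group G (carrier G) L) (section_S_ring G \<A> (carrier G) L)"
  shows "coset_S_ring G \<A>"
proof -
  have S: "S_ring G \<A>" and cyc: "cyclic_group G" using circ by (auto simp: circulant_S_ring_def)
  have sec: "A_section G \<A> U L" and LG: "L \<lhd> G" 
    and rad: "\<And>X. \<lbrakk>X \<in> basic_sets G \<A>; X \<subseteq> carrier G - U\<rbrakk> \<Longrightarrow> L \<subseteq> rad G X"
    using wr by (auto simp: gen_wreath_def)
  note sr = S_ringD[OF S]
  note U = A_sectionD(1,2)[OF S sec] and L = A_sectionD(3-5)[OF S sec]
  interpret group G using sr(1) .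
  interpret U: subgroup U G using U(1) .
  have "A_group G \<A> {\<one>\<^bsub>G\<^esub>}" "A_group G \<A> (carrier G)"
    using indicator_basic_set[OF S sr(4)] triv_subgroup subgroup_self
      indicator_mem_iff[OF S subset_refl] basic_set_subset_carrier[OF S]
    by (auto simp: A_group_iff[OF S])
  moreover have "{\<one>\<^bsub>G\<^esub>} \<lhd> G\<lparr>carrier := U\<rparr>"
    using group.one_is_normal[OF subgroup_imp_group[OF U(1)]] by simp
  ultimately have secU: "A_section G \<A> U {\<one>\<^bsub>G\<^esub>}" and secQ: "A_section G \<A> (carrier G) L"
    using sec LG by (auto simp: A_section_def)
  have "\<exists>H. subgroup H G \<and> X \<in> rcosets\<^bsub>G\<^esub> H" if X: "X \<in> basic_sets G \<A>" for X
  proof (cases "X \<subseteq> U")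
    case True
    then show ?thesis
      using basic_set_subset_carrier[OF S X] by (intro coset_from_section[OF S secU CU X]) auto
  next
    case False
    then have "X \<inter> U = {}" using basic_set_subset[OF S U(2) X] by blast
    then have "L \<subseteq> rad G X" using basic_set_subset_carrier[OF S X] by (intro rad[OF X]) blast
    then have "l \<otimes>\<^bsub>G\<^esub> x \<in> X" if "l \<in> L" "x \<in> X" for l x
      using that by (auto simp: rad_def l_coset_def)
    then show ?thesis
      using basic_set_subset_carrier[OF S X] by (intro coset_from_section[OF S secQ CQ X])
  qed
  then show ?thesis using S cyclic_imp_abelian_group[OF cyc] by (simp add: coset_S_ring_def)
qed

section \<open>Quasidensity\<close>

lemma basic_singletons_all_A_groups:
  assumes S: "S_ring G \<A>" and single: "\<And>X. X \<in> basic_sets G \<A> \<Longrightarrow> \<exists>x. X = {x}"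
    and H: "subgroup H G"
  shows "A_group G \<A> H"
  unfolding A_group_iff[OF S] indicator_mem_iff[OF S subgroup.subset[OF H]]
proof (intro conjI H ballI impI)
  fix X assume "X \<in> basic_sets G \<A>" "X \<inter> H \<noteq> {}"
  moreover obtain x where "X = {x}" using single[OF \<open>X \<in> _\<close>] by blast
  ultimately show "X \<subseteq> H" by simp
qed

text \<open>
  For a prime \<open>p\<close> dividing the order, Sylow's theorem for the exponent \<open>1\<close> (that is, Cauchy's
  theorem) gives a subgroup of order \<open>p\<close>, which must be everything.
\<close>

lemma prime_order_if_no_proper_subgroup:
  assumes G: "group G" and fin: "finite (carrier G)" and nontriv: "carrier G \<noteq> {\<one>\<^bsub>G\<^esub>}"
    and sub: "\<And>H. subgroup H G \<Longrightarrow> H = {\<one>\<^bsub>G\<^esub>} \<or> H = carrier G"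
  shows "prime (order G)"
proof -
  interpret group G by fact
  have "order G \<noteq> 1"
  proof
    assume "order G = 1"
    then obtain x where x: "carrier G = {x}" by (auto simp: order_def card_1_singleton_iff)
    have "\<one>\<^bsub>G\<^esub> \<in> {x}" using one_closed unfolding x .
    then show False using nontriv x by simp
  qed
  then obtain p where p: "prime p" "p dvd order G" using prime_factor_nat by blast
  then obtain m where "order G = p ^ 1 * m" by auto
  then obtain H where H: "subgroup H G" "card H = p ^ 1"
    using sylow_thm[OF p(1) G _ fin] by blast
  have "H \<noteq> {\<one>\<^bsub>G\<^esub>}" using H(2) p(1) by auto
  then have "H = carrier G" using sub[OF H(1)] by blast
  then show ?thesis using H(2) p(1) by (simp add: order_def)
qed

text \<open>
  For \<open>X = H x\<close> in an abelian group, \<open>X \<cdot> X\<^sup>-\<^sup>1 = H\<close>, and a product of basic sets is a union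
  of basic sets.
\<close>

lemma coset_stabilizer_A_group:
  assumes S: "S_ring G \<A>" and comm: "comm_group G" and X: "X \<in> basic_sets G \<A>"
    and H: "subgroup H G" "X \<in> rcosets\<^bsub>G\<^esub> H"
  shows "A_group G \<A> H"
proof -
  interpret comm_group G by fact
  interpret H: subgroup H G by fact
  obtain x where x: "x \<in> carrier G" "X = H #>\<^bsub>G\<^esub> x" using H(2) by (auto simp: RCOSETS_def)
  have X': "(\<lambda>x. inv\<^bsub>G\<^esub> x) ` X \<in> basic_sets G \<A>" using S_ringD(6)[OF S X] .
  have xX: "x \<in> X" using rcos_self[OF x(1) H(1)] x(2) by simp
  have XG: "X \<subseteq> carrier G" using basic_set_subset_carrier[OF S X] .
  have "X <#>\<^bsub>G\<^esub> ((\<lambda>x. inv\<^bsub>G\<^esub> x) ` X) = H"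
  proof (intro equalityI subsetI)
    fix z assume "z \<in> X <#>\<^bsub>G\<^esub> ((\<lambda>x. inv\<^bsub>G\<^esub> x) ` X)"
    then obtain h k where hk: "h \<in> H" "k \<in> H" "z = (h \<otimes>\<^bsub>G\<^esub> x) \<otimes>\<^bsub>G\<^esub> inv\<^bsub>G\<^esub> (k \<otimes>\<^bsub>G\<^esub> x)"
      unfolding x(2) by (auto simp: set_mult_def r_coset_def)
    then have "z = h \<otimes>\<^bsub>G\<^esub> inv\<^bsub>G\<^esub> k"
      using x(1) H.mem_carrier by (simp add: inv_mult_group m_assoc) (simp flip: m_assoc)
    then show "z \<in> H" using hk by simp
  next
    fix h assume h: "h \<in> H"
    then have "h \<otimes>\<^bsub>G\<^esub> x \<in> X" unfolding x(2) by (auto simp: r_coset_def)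
    moreover have "h = (h \<otimes>\<^bsub>G\<^esub> x) \<otimes>\<^bsub>G\<^esub> inv\<^bsub>G\<^esub> x" using h x(1) by (simp add: m_assoc)
    ultimately show "h \<in> X <#>\<^bsub>G\<^esub> ((\<lambda>x. inv\<^bsub>G\<^esub> x) ` X)" using xX unfolding set_mult_def by blast
  qed
  then have "indicator H \<in> \<A>"
    using indicator_set_mult[OF S XG indicator_basic_set[OF S X] basic_set_subset_carrier[OF S X']
        indicator_basic_set[OF S X']] by simp
  then show ?thesis using H(1) by (simp add: A_group_iff[OF S])
qed

text \<open>
  If a basic set is a coset of \<open>H\<close>, then \<open>H\<close> is an \<open>\<A>\<close>-group, so by primitivity it is trivial
  or the whole group. The whole group is impossible since \<open>{\<one>}\<close> is a basic set; hence all basic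
  sets are singletons. But then every subgroup is an \<open>\<A>\<close>-group, so there is no proper
  nontrivial subgroup at all.
\<close>

lemma primitive_coset_S_ring_prime_order:
  assumes C: "coset_S_ring G \<A>" and prim: "primitive_S_ring G \<A>"
  shows "prime (order G)"
proof -
  have S: "S_ring G \<A>" and comm: "comm_group G" using C by (auto simp: coset_S_ring_def)
  interpret comm_group G by fact
  note sr = S_ringD[OF S]
  have sub: "H = {\<one>\<^bsub>G\<^esub>} \<or> H = carrier G" if "A_group G \<A> H" for H
    using prim that by (auto simp: primitive_S_ring_def)
  have nt: "carrier G \<noteq> {\<one>\<^bsub>G\<^esub>}" using prim by (simp add: primitive_S_ring_def)
  have single: "\<exists>x. X = {x}" if X: "X \<in> basic_sets G \<A>" for X
  proof -
    obtain H where H: "subgroup H G" "X \<in> rcosets\<^bsub>G\<^esub> H"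
      using C X unfolding coset_S_ring_def by blast
    obtain x where x: "x \<in> carrier G" "X = H #>\<^bsub>G\<^esub> x" using H(2) by (auto simp: RCOSETS_def)
    have "H \<noteq> carrier G"
    proof
      assume "H = carrier G"
      then have "X = carrier G" using x coset_join2[OF x(1) H(1)] by simp
      then have "X = {\<one>\<^bsub>G\<^esub>}" by (intro basic_set_eqI[OF S X sr(4), of "\<one>\<^bsub>G\<^esub>"]) auto
      then show False using \<open>X = carrier G\<close> nt by simp
    qed
    then have "H = {\<one>\<^bsub>G\<^esub>}" using sub[OF coset_stabilizer_A_group[OF S comm X H]] by blast
    then have "X = {x}" using x by (auto simp: r_coset_def)
    then show ?thesis by blast
  qed
  show ?thesis
    using basic_singletons_all_A_groups[OF S single] sub
    by (intro prime_order_if_no_proper_subgroup[OF sr(1,2) nt]) blast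
qed

lemma coset_S_ring_quasidense:
  assumes C: "coset_S_ring G \<A>" and cyc: "cyclic_group G"
  shows "quasidense G \<A>"
  using C cyc coset_S_ring_section(1)[OF C cyc] primitive_coset_S_ring_prime_order
  unfolding quasidense_def circulant_S_ring_def coset_S_ring_def by blast

section \<open>Tensor products\<close>

text \<open>
  Convolution over a direct product is convolution in one variable, summed over the other. As
  either variable can play the first role, constancy of a product on \<open>X\<^sub>1 \<times> X\<^sub>2\<close> can be checked
  in one variable at a time.
\<close>

lemma group_ring_mult_DirProd:
  assumes G1: "group G\<^sub>1" and G2: "group G\<^sub>2" and z: "z\<^sub>1 \<in> carrier G\<^sub>1" "z\<^sub>2 \<in> carrier G\<^sub>2"
  shows "(f \<otimes>\<^bsub>group_ring (G\<^sub>1 \<times>\<times> G\<^sub>2)\<^esub> g) (z\<^sub>1, z\<^sub>2) =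
      (\<Sum>x\<^sub>2\<in>carrier G\<^sub>2. ((\<lambda>x. f (x, x\<^sub>2)) \<otimes>\<^bsub>group_ring G\<^sub>1\<^esub> (\<lambda>y. g (y, inv\<^bsub>G\<^sub>2\<^esub> x\<^sub>2 \<otimes>\<^bsub>G\<^sub>2\<^esub> z\<^sub>2))) z\<^sub>1)"
    and "(f \<otimes>\<^bsub>group_ring (G\<^sub>1 \<times>\<times> G\<^sub>2)\<^esub> g) (z\<^sub>1, z\<^sub>2) =
      (\<Sum>x\<^sub>1\<in>carrier G\<^sub>1. ((\<lambda>x. f (x\<^sub>1, x)) \<otimes>\<^bsub>group_ring G\<^sub>2\<^esub> (\<lambda>y. g (inv\<^bsub>G\<^sub>1\<^esub> x\<^sub>1 \<otimes>\<^bsub>G\<^sub>1\<^esub> z\<^sub>1, y))) z\<^sub>2)"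
proof -
  interpret G1: group G\<^sub>1 by fact
  interpret G2: group G\<^sub>2 by fact
  interpret P: group "G\<^sub>1 \<times>\<times> G\<^sub>2" by (rule DirProd_group[OF G1 G2])
  let ?t = "\<lambda>x\<^sub>1 x\<^sub>2. f (x\<^sub>1, x\<^sub>2) * g (inv\<^bsub>G\<^sub>1\<^esub> x\<^sub>1 \<otimes>\<^bsub>G\<^sub>1\<^esub> z\<^sub>1, inv\<^bsub>G\<^sub>2\<^esub> x\<^sub>2 \<otimes>\<^bsub>G\<^sub>2\<^esub> z\<^sub>2)"
  have "(f \<otimes>\<^bsub>group_ring (G\<^sub>1 \<times>\<times> G\<^sub>2)\<^esub> g) (z\<^sub>1, z\<^sub>2) =
      (\<Sum>(x\<^sub>1, x\<^sub>2)\<in>carrier G\<^sub>1 \<times> carrier G\<^sub>2. ?t x\<^sub>1 x\<^sub>2)"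
    using z by (subst P.group_ring_mult) (auto simp: inv_DirProd[OF G1 G2] intro!: sum.cong)
  then have eq: "(f \<otimes>\<^bsub>group_ring (G\<^sub>1 \<times>\<times> G\<^sub>2)\<^esub> g) (z\<^sub>1, z\<^sub>2) =
      (\<Sum>x\<^sub>1\<in>carrier G\<^sub>1. \<Sum>x\<^sub>2\<in>carrier G\<^sub>2. ?t x\<^sub>1 x\<^sub>2)"
    by (simp add: sum.cartesian_product)
  then show "(f \<otimes>\<^bsub>group_ring (G\<^sub>1 \<times>\<times> G\<^sub>2)\<^esub> g) (z\<^sub>1, z\<^sub>2) =
      (\<Sum>x\<^sub>1\<in>carrier G\<^sub>1. ((\<lambda>x. f (x\<^sub>1, x)) \<otimes>\<^bsub>group_ring G\<^sub>2\<^esub> (\<lambda>y. g (inv\<^bsub>G\<^sub>1\<^esub> x\<^sub>1 \<otimes>\<^bsub>G\<^sub>1\<^esub> z\<^sub>1, y))) z\<^sub>2)"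
    by (simp add: G2.group_ring_mult[OF z(2)])
  show "(f \<otimes>\<^bsub>group_ring (G\<^sub>1 \<times>\<times> G\<^sub>2)\<^esub> g) (z\<^sub>1, z\<^sub>2) =
      (\<Sum>x\<^sub>2\<in>carrier G\<^sub>2. ((\<lambda>x. f (x, x\<^sub>2)) \<otimes>\<^bsub>group_ring G\<^sub>1\<^esub> (\<lambda>y. g (y, inv\<^bsub>G\<^sub>2\<^esub> x\<^sub>2 \<otimes>\<^bsub>G\<^sub>2\<^esub> z\<^sub>2))) z\<^sub>1)"
    unfolding eq by (subst sum.swap) (simp add: G1.group_ring_mult[OF z(1)])
qed

text \<open>
  If \<open>f\<close> is constant on the products of basic sets, then each of its slices \<open>f (\<cdot>, y)\<close> and
  \<open>f (y', \<cdot>)\<close> lies in the corresponding factor. To compare a convolution at two points of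
  \<open>X\<^sub>1 \<times> X\<^sub>2\<close>, pass through \<open>(b\<^sub>1, a\<^sub>2)\<close>: the step in the first coordinate uses
  the ring \<open>\<A>\<^sub>1\<close>, the step in the second the ring \<open>\<A>\<^sub>2\<close>.
\<close>

lemma S_ring_tensor:
  assumes S1: "S_ring G\<^sub>1 \<A>\<^sub>1" and S2: "S_ring G\<^sub>2 \<A>\<^sub>2"
  shows "S_ring (G\<^sub>1 \<times>\<times> G\<^sub>2) (tensor_S_ring G\<^sub>1 \<A>\<^sub>1 G\<^sub>2 \<A>\<^sub>2)"
    and "basic_sets (G\<^sub>1 \<times>\<times> G\<^sub>2) (tensor_S_ring G\<^sub>1 \<A>\<^sub>1 G\<^sub>2 \<A>\<^sub>2) =
      {X\<^sub>1 \<times> X\<^sub>2 | X\<^sub>1 X\<^sub>2. X\<^sub>1 \<in> basic_sets G\<^sub>1 \<A>\<^sub>1 \<and> X\<^sub>2 \<in> basic_sets G\<^sub>2 \<A>\<^sub>2}"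
proof -
  let ?P = "G\<^sub>1 \<times>\<times> G\<^sub>2"
  let ?T = "{X\<^sub>1 \<times> X\<^sub>2 | X\<^sub>1 X\<^sub>2. X\<^sub>1 \<in> basic_sets G\<^sub>1 \<A>\<^sub>1 \<and> X\<^sub>2 \<in> basic_sets G\<^sub>2 \<A>\<^sub>2}"
  note s1 = S_ringD[OF S1] and s2 = S_ringD[OF S2]
  interpret G1: group G\<^sub>1 by (fact s1(1))
  interpret G2: group G\<^sub>2 by (fact s2(1))
  have fin: "finite (carrier ?P)" using s1(2) s2(2) by simp
  have part: "partition_on (carrier ?P) ?T"
  proof (rule partition_onI)
    show "\<Union>?T = carrier ?P"
      using partition_onD1[OF s1(3)] partition_onD1[OF s2(3)] by auto
    show "{} \<notin> ?T" using basic_set_nonempty[OF S1] basic_set_nonempty[OF S2] by fastforce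
    fix p q assume "p \<in> ?T" "q \<in> ?T" and ne: "p \<noteq> q"
    then obtain X\<^sub>1 X\<^sub>2 Y\<^sub>1 Y\<^sub>2 where XY: "X\<^sub>1 \<in> basic_sets G\<^sub>1 \<A>\<^sub>1" "X\<^sub>2 \<in> basic_sets G\<^sub>2 \<A>\<^sub>2"
        "Y\<^sub>1 \<in> basic_sets G\<^sub>1 \<A>\<^sub>1" "Y\<^sub>2 \<in> basic_sets G\<^sub>2 \<A>\<^sub>2" "p = X\<^sub>1 \<times> X\<^sub>2" "q = Y\<^sub>1 \<times> Y\<^sub>2"
      by blast
    show "disjnt p q"
    proof (rule ccontr)
      assume "\<not> disjnt p q"
      then obtain x y where "x \<in> X\<^sub>1" "x \<in> Y\<^sub>1" "y \<in> X\<^sub>2" "y \<in> Y\<^sub>2" using XY(5,6) by (auto simp: disjnt_iff)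
      then have "X\<^sub>1 = Y\<^sub>1" "X\<^sub>2 = Y\<^sub>2"
        using basic_set_eqI[OF S1 XY(1,3)] basic_set_eqI[OF S2 XY(2,4)] by simp_all
      then show False using ne XY(5,6) by simp
    qed
  qed
  have one: "{\<one>\<^bsub>?P\<^esub>} \<in> ?T"
    using s1(4) s2(4) by (intro CollectI exI[of _ "{\<one>\<^bsub>G\<^sub>1\<^esub>}"] exI[of _ "{\<one>\<^bsub>G\<^sub>2\<^esub>}"]) simp
  have inv: "(\<lambda>a. inv\<^bsub>?P\<^esub> a) ` Z \<in> ?T" if Z: "Z \<in> ?T" for Z
  proof -
    obtain X\<^sub>1 X\<^sub>2 where X: "X\<^sub>1 \<in> basic_sets G\<^sub>1 \<A>\<^sub>1" "X\<^sub>2 \<in> basic_sets G\<^sub>2 \<A>\<^sub>2" "Z = X\<^sub>1 \<times> X\<^sub>2"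
      using Z by blast
    have "(\<lambda>a. inv\<^bsub>?P\<^esub> a) ` Z = map_prod (\<lambda>x. inv\<^bsub>G\<^sub>1\<^esub> x) (\<lambda>x. inv\<^bsub>G\<^sub>2\<^esub> x) ` Z"
      unfolding X(3)
      using basic_set_subset_carrier[OF S1 X(1)] basic_set_subset_carrier[OF S2 X(2)]
      by (intro image_cong refl) (auto simp: subset_iff inv_DirProd[OF s1(1) s2(1)])
    also have "\<dots> = (\<lambda>x. inv\<^bsub>G\<^sub>1\<^esub> x) ` X\<^sub>1 \<times> (\<lambda>x. inv\<^bsub>G\<^sub>2\<^esub> x) ` X\<^sub>2"
      unfolding X(3) by (rule map_prod_surj_on[OF refl refl])
    finally show ?thesis using s1(6)[OF X(1)] s2(6)[OF X(2)] by blast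
  qed
  have slice: "(\<lambda>x. f (x, y)) \<in> \<A>\<^sub>1" "(\<lambda>x. f (y', x)) \<in> \<A>\<^sub>2"
    if f: "f \<in> int_span ?T" and y: "y \<in> carrier G\<^sub>2" and y': "y' \<in> carrier G\<^sub>1" for f y y'
  proof -
    have zero: "f (x, z) = 0" if "x \<notin> carrier G\<^sub>1 \<or> z \<notin> carrier G\<^sub>2" for x z
      using that by (intro int_span_zero[OF part f]) auto
    show "(\<lambda>x. f (x, y)) \<in> \<A>\<^sub>1"
    proof (rule S_ring_memI[OF S1])
      fix X x x' assume X: "X \<in> basic_sets G\<^sub>1 \<A>\<^sub>1" "x \<in> X" "x' \<in> X"
      obtain Y where "Y \<in> basic_sets G\<^sub>2 \<A>\<^sub>2" "y \<in> Y" using basic_set_cover[OF S2 y] .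
      then show "f (x, y) = f (x', y)"
        using X by (intro int_span_const[OF fin part f, of "X \<times> Y"]) auto
    qed (use zero in simp)
    show "(\<lambda>x. f (y', x)) \<in> \<A>\<^sub>2"
    proof (rule S_ring_memI[OF S2])
      fix X x x' assume X: "X \<in> basic_sets G\<^sub>2 \<A>\<^sub>2" "x \<in> X" "x' \<in> X"
      obtain Y where "Y \<in> basic_sets G\<^sub>1 \<A>\<^sub>1" "y' \<in> Y" using basic_set_cover[OF S1 y'] .
      then show "f (y', x) = f (y', x')"
        using X by (intro int_span_const[OF fin part f, of "Y \<times> X"]) auto
    qed (use zero in simp)
  qed
  have conv: "(f \<otimes>\<^bsub>group_ring ?P\<^esub> g) a = (f \<otimes>\<^bsub>group_ring ?P\<^esub> g) b"
    if f: "f \<in> int_span ?T" and g: "g \<in> int_span ?T" and Z: "Z \<in> ?T" "a \<in> Z" "b \<in> Z" for f g Z a b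
  proof -
    obtain X\<^sub>1 X\<^sub>2 where X: "X\<^sub>1 \<in> basic_sets G\<^sub>1 \<A>\<^sub>1" "X\<^sub>2 \<in> basic_sets G\<^sub>2 \<A>\<^sub>2" "Z = X\<^sub>1 \<times> X\<^sub>2"
      using Z(1) by blast
    obtain a\<^sub>1 a\<^sub>2 b\<^sub>1 b\<^sub>2 where ab: "a = (a\<^sub>1, a\<^sub>2)" "b = (b\<^sub>1, b\<^sub>2)" "a\<^sub>1 \<in> X\<^sub>1" "a\<^sub>2 \<in> X\<^sub>2" "b\<^sub>1 \<in> X\<^sub>1" "b\<^sub>2 \<in> X\<^sub>2"
      using Z(2,3) unfolding X(3) by blast
    have c: "a\<^sub>1 \<in> carrier G\<^sub>1" "b\<^sub>1 \<in> carrier G\<^sub>1" "a\<^sub>2 \<in> carrier G\<^sub>2" "b\<^sub>2 \<in> carrier G\<^sub>2"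
      using ab basic_set_subset_carrier[OF S1 X(1)] basic_set_subset_carrier[OF S2 X(2)] by auto
    have "(f \<otimes>\<^bsub>group_ring ?P\<^esub> g) (a\<^sub>1, a\<^sub>2) = (f \<otimes>\<^bsub>group_ring ?P\<^esub> g) (b\<^sub>1, a\<^sub>2)"
      unfolding group_ring_mult_DirProd(1)[OF s1(1) s2(1) c(1,3)]
        group_ring_mult_DirProd(1)[OF s1(1) s2(1) c(2,3)]
      by (intro sum.cong refl S_ring_mem_const[OF S1 _ X(1) ab(3,5)] s1(7)
          slice(1)[OF f _ c(1)] slice(1)[OF g _ c(1)]) (use c in auto)
    also have "\<dots> = (f \<otimes>\<^bsub>group_ring ?P\<^esub> g) (b\<^sub>1, b\<^sub>2)"
      unfolding group_ring_mult_DirProd(2)[OF s1(1) s2(1) c(2,3)]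
        group_ring_mult_DirProd(2)[OF s1(1) s2(1) c(2,4)]
      by (intro sum.cong refl S_ring_mem_const[OF S2 _ X(2) ab(4,6)] s2(7)
          slice(2)[OF f c(3)] slice(2)[OF g c(3)]) (use c in auto)
    finally show ?thesis unfolding ab(1,2) .
  qed
  show "S_ring ?P (tensor_S_ring G\<^sub>1 \<A>\<^sub>1 G\<^sub>2 \<A>\<^sub>2)" "basic_sets ?P (tensor_S_ring G\<^sub>1 \<A>\<^sub>1 G\<^sub>2 \<A>\<^sub>2) = ?T"
    unfolding tensor_S_ring_def
    by (rule S_ring_int_span[OF DirProd_group[OF s1(1) s2(1)] fin part one inv conv]; assumption)+
qed

lemma coset_S_ring_tensor:
  assumes C1: "coset_S_ring G\<^sub>1 \<A>\<^sub>1" and C2: "coset_S_ring G\<^sub>2 \<A>\<^sub>2" and comm: "comm_group (G\<^sub>1 \<times>\<times> G\<^sub>2)"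
  shows "coset_S_ring (G\<^sub>1 \<times>\<times> G\<^sub>2) (tensor_S_ring G\<^sub>1 \<A>\<^sub>1 G\<^sub>2 \<A>\<^sub>2)"
proof -
  have S1: "S_ring G\<^sub>1 \<A>\<^sub>1" and S2: "S_ring G\<^sub>2 \<A>\<^sub>2" using C1 C2 by (auto simp: coset_S_ring_def)
  have "\<exists>H. subgroup H (G\<^sub>1 \<times>\<times> G\<^sub>2) \<and> Z \<in> rcosets\<^bsub>G\<^sub>1 \<times>\<times> G\<^sub>2\<^esub> H"
    if Z: "Z \<in> basic_sets (G\<^sub>1 \<times>\<times> G\<^sub>2) (tensor_S_ring G\<^sub>1 \<A>\<^sub>1 G\<^sub>2 \<A>\<^sub>2)" for Z
  proof -
    obtain X\<^sub>1 X\<^sub>2 where X: "X\<^sub>1 \<in> basic_sets G\<^sub>1 \<A>\<^sub>1" "X\<^sub>2 \<in> basic_sets G\<^sub>2 \<A>\<^sub>2" "Z = X\<^sub>1 \<times> X\<^sub>2"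
      using Z unfolding S_ring_tensor(2)[OF S1 S2] by blast
    obtain H\<^sub>1 where H1: "subgroup H\<^sub>1 G\<^sub>1" "X\<^sub>1 \<in> rcosets\<^bsub>G\<^sub>1\<^esub> H\<^sub>1"
      using C1 X(1) unfolding coset_S_ring_def by blast
    obtain H\<^sub>2 where H2: "subgroup H\<^sub>2 G\<^sub>2" "X\<^sub>2 \<in> rcosets\<^bsub>G\<^sub>2\<^esub> H\<^sub>2"
      using C2 X(2) unfolding coset_S_ring_def by blast
    obtain x\<^sub>1 where x1: "x\<^sub>1 \<in> carrier G\<^sub>1" "X\<^sub>1 = H\<^sub>1 #>\<^bsub>G\<^sub>1\<^esub> x\<^sub>1" using H1(2) by (auto simp: RCOSETS_def)
    obtain x\<^sub>2 where x2: "x\<^sub>2 \<in> carrier G\<^sub>2" "X\<^sub>2 = H\<^sub>2 #>\<^bsub>G\<^sub>2\<^esub> x\<^sub>2" using H2(2) by (auto simp: RCOSETS_def)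
    have "Z = (H\<^sub>1 \<times> H\<^sub>2) #>\<^bsub>G\<^sub>1 \<times>\<times> G\<^sub>2\<^esub> (x\<^sub>1, x\<^sub>2)"
      unfolding X(3) x1(2) x2(2) by (auto simp: r_coset_def)
    then have "Z \<in> rcosets\<^bsub>G\<^sub>1 \<times>\<times> G\<^sub>2\<^esub> (H\<^sub>1 \<times> H\<^sub>2)" using x1(1) x2(1) by (auto simp: RCOSETS_def)
    then show ?thesis
      using DirProd_subgroups[OF S_ringD(1)[OF S1] H1(1) S_ringD(1)[OF S2] H2(1)] by blast
  qed
  then show ?thesis using S_ring_tensor(1)[OF S1 S2] comm by (simp add: coset_S_ring_def)
qed

section \<open>Closure properties and quasidensity\<close>

theorem theorem8p4:
  shows
    "(\<forall>(G :: ('a, 'm) monoid_scheme) \<A> U L.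
        coset_S_ring G \<A> \<and> cyclic_group G \<and> A_section G \<A> U L \<longrightarrow>
        coset_S_ring (section_group G U L) (section_S_ring G \<A> U L) \<and>
        cyclic_group (section_group G U L)) \<and>
     (\<forall>(G\<^sub>1 :: ('b, 'n) monoid_scheme) \<A>\<^sub>1 (G\<^sub>2 :: ('c, 'k) monoid_scheme) \<A>\<^sub>2.
        coset_S_ring G\<^sub>1 \<A>\<^sub>1 \<and> cyclic_group G\<^sub>1 \<and>
        coset_S_ring G\<^sub>2 \<A>\<^sub>2 \<and> cyclic_group G\<^sub>2 \<and>
        cyclic_group (G\<^sub>1 \<times>\<times> G\<^sub>2) \<longrightarrow>
        coset_S_ring (G\<^sub>1 \<times>\<times> G\<^sub>2) (tensor_S_ring G\<^sub>1 \<A>\<^sub>1 G\<^sub>2 \<A>\<^sub>2)) \<and>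
     (\<forall>(G :: ('d, 'l) monoid_scheme) \<A> U L.
        circulant_S_ring G \<A> \<and> gen_wreath G \<A> U L \<and>
        coset_S_ring (section_group G U {\<one>\<^bsub>G\<^esub>}) (section_S_ring G \<A> U {\<one>\<^bsub>G\<^esub>}) \<and>
        coset_S_ring (section_group G (carrier G) L) (section_S_ring G \<A> (carrier G) L) \<longrightarrow>
        coset_S_ring G \<A>) \<and>
     (\<forall>(G :: ('e, 'q) monoid_scheme) \<A>.
        coset_S_ring G \<A> \<and> cyclic_group G \<longrightarrow> quasidense G \<A>)"
proof (intro conjI allI impI; elim conjE)
  fix G :: "('a, 'm) monoid_scheme" and \<A> U L
  assume "coset_S_ring G \<A>" "cyclic_group G" "A_section G \<A> U L"
  then show "coset_S_ring (section_group G U L) (section_S_ring G \<A> U L)"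
    and "cyclic_group (section_group G U L)"
    by (rule coset_S_ring_section)+
next
  fix G\<^sub>1 :: "('b, 'n) monoid_scheme" and G\<^sub>2 :: "('c, 'k) monoid_scheme" and \<A>\<^sub>1 \<A>\<^sub>2
  assume C: "coset_S_ring G\<^sub>1 \<A>\<^sub>1" "coset_S_ring G\<^sub>2 \<A>\<^sub>2" and cyc: "cyclic_group (G\<^sub>1 \<times>\<times> G\<^sub>2)"
  have "group (G\<^sub>1 \<times>\<times> G\<^sub>2)"
    using C by (intro DirProd_group) (auto simp: coset_S_ring_def S_ring_def)
  then have "comm_group (G\<^sub>1 \<times>\<times> G\<^sub>2)" using cyc by (rule group.cyclic_imp_abelian_group)
  then show "coset_S_ring (G\<^sub>1 \<times>\<times> G\<^sub>2) (tensor_S_ring G\<^sub>1 \<A>\<^sub>1 G\<^sub>2 \<A>\<^sub>2)"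
    by (rule coset_S_ring_tensor[OF C])
qed (fact coset_S_ring_gen_wreath coset_S_ring_quasidense)+

end
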